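(* Let $\Xi\subseteq\mathbb{R}^m$ be convex, $\widehat\xi_1,\dots,\widehat\xi_N\in\Xi$, $\widehat{\mathbb P}_N=\frac1N\sum_{i=1}^N\delta_{\widehat\xi_i}$, $\varepsilon\ge0$, let $\|\cdot\|$ be a norm on $\mathbb{R}^m$, and let $\rho$ be a law-invariant coherent risk measure. Suppose $\ell:\mathbb{R}^m\to\mathbb{R}$ is convex piecewise linear, i.e. $\ell=\max_{k=1,\dots,K}\ell_k$ with $\ell_k$, $k=1,\dots,K$, linear (affine) functions. Then the worst-case expectation problem $$\sup_{\Pi}\ \mathbb{E}^{\Pi}[\ell(\xi)]\quad\text{subject to}\quad \rho^{\Pi}(\|\widehat\xi-\xi\|)\le\varepsilon,$$ where $\Pi$ ranges over the probability distributions on $\Xi\times\Xi$ of a pair $(\widehat\xi,\xi)$ with first marginal $\widehat{\mathbb P}_N$, is equivalent (same optimal value) to $$\begin{aligned}\sup_{p_{ij},\,\xi_{ij}}\ \ &\frac1N\sum_{i=1}^N\sum_{j=1}^K p_{ij}\,\ell_j(\xi_{ij})\\ \text{subject to}\ \ &\rho^{\Pi}(\|\widehat\xi-\xi\|)\le\varepsilon,\\ &\Pi\big((\widehat\xi,\xi)=(\widehat\xi_i,\xi_{ij})\big)=\tfrac1N p_{ij},\quad p_{ij}\ge0,\quad \xi_{ij}\in\Xi,\quad\forall i,j,\\ &\sum_{j=1}^K p_{ij}=1,\quad i=1,\dots,N,\end{aligned}$$ i.e. where $\Pi=\frac1N\sum_{i=1}^N\sum_{j=1}^K p_{ij}\,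\delta_{(\widehat\xi_i,\xi_{ij})}$.
   Context: A law-invariant coherent risk measure $\rho$ is a functional on nonnegative random variables (transportation costs) on an atomless probability space, with values in $[0,\infty]$, satisfying $\rho(0)=0$, translation invariance $\rho(X+c)=\rho(X)+c$ for $c\ge0$, monotonicity ($X_1\ge X_2$ implies $\rho(X_1)\ge\rho(X_2)$), subadditivity, positive homogeneity $\rho(cX)=c\rho(X)$ for $c>0$, and law invariance. $\rho^{\Pi}(\|\widehat\xi-\xi\|)$ is the value of $\rho$ on the law of $\|\widehat\xi-\xi\|$ when $(\widehat\xi,\xi)\sim\Pi$. *)

theory Defs
  imports "HOL-Probability.Probability"
begin

definition is_norm :: "('a::real_vector \<Rightarrow> real) \<Rightarrow> bool" where
  "is_norm n \<longleftrightarrow>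
     (\<forall>x. n x = 0 \<longleftrightarrow> x = 0) \<and>
     (\<forall>c x. n (c *\<^sub>R x) = \<bar>c\<bar> * n x) \<and>
     (\<forall>x y. n (x + y) \<le> n x + n y)"

definition is_affine :: "('a::real_vector \<Rightarrow> real) \<Rightarrow> bool" where
  "is_affine f \<longleftrightarrow> (\<exists>h c. linear h \<and> f = (\<lambda>x. h x + c))"

(* Extended-real expectation, also meaningful for integrands that are not integrable.
   The only undetermined case, both parts infinite, does not occur for a convex piecewise
   linear loss under a finite transport risk, since the risk dominates the expectation. *)
definition ext_expectation :: "'a measure \<Rightarrow> ('a \<Rightarrow> real) \<Rightarrow> ereal" where
  "ext_expectation M f =
     enn2ereal (\<integral>\<^sup>+x. ennreal (f x) \<partial>M) - enn2ereal (\<integral>\<^sup>+x. ennreal (- f x) \<partial>M)"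

locale atomless_prob_space = prob_space +
  assumes atomless:
    "A \<in> sets M \<Longrightarrow> 0 < emeasure M A \<Longrightarrow>
       \<exists>B\<in>sets M. B \<subseteq> A \<and> 0 < emeasure M B \<and> emeasure M B < emeasure M A"

definition nonneg_rv :: "'s measure \<Rightarrow> ('s \<Rightarrow> real) set" where
  "nonneg_rv S = {X \<in> borel_measurable S. \<forall>\<omega>\<in>space S. 0 \<le> X \<omega>}"

(* Positive homogeneity is only required for c > 0, so that 0 * \<infinity> never enters. *)
locale law_invariant_coherent_risk = atomless_prob_space S
  for S :: "'s measure" +
  fixes \<rho> :: "('s \<Rightarrow> real) \<Rightarrow> ennreal"
  assumes risk_zero: "\<rho> (\<lambda>_. 0) = 0"
    and translation:
      "X \<in> nonneg_rv S \<Longrightarrow> 0 \<le> c \<Longrightarrow> \<rho> (\<lambda>\<omega>. X \<omega> + c) = \<rho> X + ennreal c"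
    and monotonicity:
      "X \<in> nonneg_rv S \<Longrightarrow> Y \<in> nonneg_rv S \<Longrightarrow> (\<And>\<omega>. \<omega> \<in> space S \<Longrightarrow> Y \<omega> \<le> X \<omega>) \<Longrightarrow> \<rho> Y \<le> \<rho> X"
    and subadditivity:
      "X \<in> nonneg_rv S \<Longrightarrow> Y \<in> nonneg_rv S \<Longrightarrow> \<rho> (\<lambda>\<omega>. X \<omega> + Y \<omega>) \<le> \<rho> X + \<rho> Y"
    and positive_homogeneity:
      "X \<in> nonneg_rv S \<Longrightarrow> 0 < c \<Longrightarrow> \<rho> (\<lambda>\<omega>. c * X \<omega>) = ennreal c * \<rho> X"
    and law_invariance:
      "X \<in> nonneg_rv S \<Longrightarrow> Y \<in> nonneg_rv S \<Longrightarrow> distr S borel X = distr S borel Y \<Longrightarrow> \<rho> X = \<rho> Y"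

(* Value of \<rho> on a law \<nu> on the nonnegative reals. On an atomless space every such law is
   the law of some random variable, and by law invariance the choice is immaterial. *)
definition risk_of_law :: "'s measure \<Rightarrow> (('s \<Rightarrow> real) \<Rightarrow> ennreal) \<Rightarrow> real measure \<Rightarrow> ennreal" where
  "risk_of_law S \<rho> \<nu> = \<rho> (SOME X. X \<in> nonneg_rv S \<and> distr S borel X = \<nu>)"

definition transport_risk ::
  "'s measure \<Rightarrow> (('s \<Rightarrow> real) \<Rightarrow> ennreal) \<Rightarrow> ('a::{real_vector, topological_space} \<Rightarrow> real) \<Rightarrow>
     ('a \<times> 'a) measure \<Rightarrow> ennreal" where
  "transport_risk S \<rho> n Q = risk_of_law S \<rho> (distr Q borel (\<lambda>(x, y). n (x - y)))"

(* The finite sum of weighted Dirac measures w k * \<delta>_{x k}, k in I, on the measurable space M;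
   the points x k need not be distinct. *)
definition discrete_measure ::
  "'a measure \<Rightarrow> 'i set \<Rightarrow> ('i \<Rightarrow> real) \<Rightarrow> ('i \<Rightarrow> 'a) \<Rightarrow> 'a measure" where
  "discrete_measure M I w x = distr (point_measure I (\<lambda>k. ennreal (w k))) M x"

lemma emeasure_discrete_measure:
  assumes "finite I" "x ` I \<subseteq> space M" "A \<in> sets M"
  shows "emeasure (discrete_measure M I w x) A = (\<Sum>k\<in>I. ennreal (w k) * indicator A (x k))"
proof -
  have "emeasure (discrete_measure M I w x) A = (\<Sum>k\<in>x -` A \<inter> I. ennreal (w k))"
    unfolding discrete_measure_def using assms
    by (subst emeasure_distr) (auto simp: space_point_measure emeasure_point_measure_finite)
  also have "\<dots> = (\<Sum>k\<in>I. ennreal (w k) * indicator A (x k))"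
    using assms(1) by (intro sum.mono_neutral_cong_left) (auto simp: indicator_def)
  finally show ?thesis .
qed

definition empirical_measure ::
  "'a::topological_space set \<Rightarrow> nat \<Rightarrow> (nat \<Rightarrow> 'a) \<Rightarrow> 'a measure" where
  "empirical_measure \<Xi> N xh =
     discrete_measure (restrict_space borel \<Xi>) {1..N} (\<lambda>_. 1 / real N) xh"

(* \<Xi> need not be a Borel set, so distributions on \<Xi> live on the trace Borel sigma-algebra. *)
definition couplings ::
  "'a::topological_space set \<Rightarrow> nat \<Rightarrow> (nat \<Rightarrow> 'a) \<Rightarrow> ('a \<times> 'a) measure set" where
  "couplings \<Xi> N xh =
     {Q. prob_space Q \<and>
         sets Q = sets (restrict_space borel \<Xi> \<Otimes>\<^sub>M restrict_space borel \<Xi>) \<and>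
         distr Q (restrict_space borel \<Xi>) fst = empirical_measure \<Xi> N xh}"

definition discrete_coupling ::
  "'a::topological_space set \<Rightarrow> nat \<Rightarrow> nat \<Rightarrow> (nat \<Rightarrow> 'a) \<Rightarrow>
     (nat \<Rightarrow> nat \<Rightarrow> real) \<Rightarrow> (nat \<Rightarrow> nat \<Rightarrow> 'a) \<Rightarrow> ('a \<times> 'a) measure" where
  "discrete_coupling \<Xi> N K xh p \<xi> =
     discrete_measure (restrict_space borel \<Xi> \<Otimes>\<^sub>M restrict_space borel \<Xi>)
       ({1..N} \<times> {1..K}) (\<lambda>(i, j). p i j / real N) (\<lambda>(i, j). (xh i, \<xi> i j))"

end

theory Submission
  imports Defs
begin

text \<open>
  A feasible finite scheme \<open>(p, \<xi>)\<close> induces a feasible coupling, and since \<open>loss\<close> dominates every piece,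
  its expected loss is at least the objective of the scheme; this gives one inequality.

  For the other one, a coupling \<open>Q\<close> is cut along the atom \<open>xh i\<close> that the first coordinate takes and
  the piece \<open>j\<close> that is active at the second coordinate, and the second coordinate is replaced by its
  conditional mean \<open>\<xi> i j\<close> on the part \<open>(i, j)\<close>.  The mean stays in \<open>\<Xi>\<close> because \<open>\<Xi>\<close> is convex
  (\<open>convex_integral_mem\<close>).  On a part the loss is affine, so its expectation is unchanged.
  By convexity of the norm, the new transport cost on a part is at most the conditional mean of the old cost there.  What remains is a statement about the risk
  measure alone, \<open>risk_of_law_mixture_of_means_le\<close>: replacing the components of a mixture of laws on
  the nonnegative reals by point masses at or below their means does not increase the risk.

  This is the classical fact that a law-invariant coherent risk measure is monotone under conditional
  expectation.  The proof avoids approximation in the supremum norm, which an unbounded cost does not admit.  It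
  realizes the mixture as \<open>X s = h L (frac (V + s))\<close>, where \<open>L\<close> is the label of the component, \<open>V\<close> is
  uniform on the unit interval and independent of \<open>L\<close>, and \<open>h k\<close> is the quantile function of
  component \<open>k\<close>.  All the rotations \<open>X (i / n)\<close> have the same law, hence the same risk, so subadditivity
  and homogeneity bound the risk of their average by the risk of the mixture.  Because \<open>h k\<close> is monotone,
  the average is, uniformly in the outcome, at least a lower Riemann sum of \<open>h L\<close>, and these sums tend
  to the mean of component \<open>L\<close>.  Only bounds from below occur, which monotonicity and translation
  invariance can exploit for unbounded variables as well.

  The one-component case of this lemma shows that the risk dominates the expectation.  A finite
  transport risk therefore makes the cost and the second coordinate integrable, so that the conditional
  means exist.  The uniform variable on the atomless space is built from a maximal chain of events.
\<close>

section \<open>Barycenters in convex sets and norms on Euclidean spaces\<close>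

text \<open>
  A supporting hyperplane alone would only place the mean in the closure of \<open>C\<close>; induction over the faces
  removes the closure.  If \<open>0\<close> is outside \<open>C\<close>, a linear functional \<open>a\<close> in the span of \<open>C\<close> is
  nonnegative on \<open>C\<close>; its integral vanishes, so \<open>f\<close> lives on the face \<open>C \<inter> {x. a \<bullet> x = 0}\<close>, whose span
  has smaller dimension.
\<close>

lemma convex_integral_zero_mem:
  fixes f :: "'b \<Rightarrow> 'a::euclidean_space"
  assumes "prob_space M" "integrable M f" "convex C" "AE x in M. f x \<in> C" "integral\<^sup>L M f = 0"
  shows "0 \<in> C"
  using assms(3,4)
proof (induction "dim C" arbitrary: C rule: less_induct)
  case less
  interpret prob_space M by fact
  show ?case
  proof (rule ccontr)
    assume "0 \<notin> C"
    have "C \<noteq> {}"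
      using less.prems(2) by (auto simp: AE_False prob_space)
    then obtain a where a: "a \<in> span C" "a \<noteq> 0" "\<And>x. x \<in> C \<Longrightarrow> 0 \<le> a \<bullet> x"
      using separating_hyperplane_set_0_inspan[OF less.prems(1)] \<open>0 \<notin> C\<close> by metis
    have "(\<integral>x. a \<bullet> f x \<partial>M) = 0"
      using assms(2,5) by simp
    moreover have "integrable M (\<lambda>x. a \<bullet> f x)"
      using assms(2) by simp
    moreover have "AE x in M. 0 \<le> a \<bullet> f x"
      using less.prems(2) by eventually_elim (rule a)
    ultimately have "AE x in M. a \<bullet> f x = 0"
      using integral_nonneg_eq_0_iff_AE by blast
    with less.prems(2) have "AE x in M. f x \<in> C \<inter> {x. a \<bullet> x = 0}"
      by eventually_elim simp
    moreover have "convex (C \<inter> {x. a \<bullet> x = 0})"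
      by (intro convex_Int less.prems convex_hyperplane)
    moreover have "dim (C \<inter> {x. a \<bullet> x = 0}) < dim C"
    proof -
      have "span (C \<inter> {x. a \<bullet> x = 0}) \<subseteq> {x. a \<bullet> x = 0}"
        by (rule span_minimal) (auto simp: subspace_hyperplane)
      with a have "a \<notin> span (C \<inter> {x. a \<bullet> x = 0})"
        by auto
      moreover have "span (C \<inter> {x. a \<bullet> x = 0}) \<subseteq> span C"
        by (rule span_mono) simp
      ultimately have "span (C \<inter> {x. a \<bullet> x = 0}) \<subset> span C"
        using a(1) by blast
      then show ?thesis
        by (rule dim_psubset)
    qed
    ultimately show False
      using less.hyps \<open>0 \<notin> C\<close> by blast
  qed
qed

lemma convex_integral_mem:
  fixes f :: "'b \<Rightarrow> 'a::euclidean_space"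
  assumes "prob_space M" "integrable M f" "convex C" "AE x in M. f x \<in> C"
  shows "integral\<^sup>L M f \<in> C"
proof -
  interpret prob_space M by fact
  define z where "z = integral\<^sup>L M f"
  have "0 \<in> (\<lambda>x. - z + x) ` C"
  proof (rule convex_integral_zero_mem[where f = "\<lambda>x. - z + f x"])
    show "AE x in M. - z + f x \<in> (\<lambda>x. - z + x) ` C"
      using assms(4) by eventually_elim blast
    show "(\<integral>x. - z + f x \<partial>M) = 0"
      using assms(2) by (simp add: z_def prob_space)
  qed (use assms in \<open>auto intro: convex_translation\<close>)
  then show ?thesis
    by (auto simp: z_def)
qed

context
  fixes n :: "'a::euclidean_space \<Rightarrow> real"
  assumes n: "is_norm n"
begin

lemma is_norm_triangle: "n (x + y) \<le> n x + n y"
  and is_norm_scale: "n (c *\<^sub>R x) = \<bar>c\<bar> * n x"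
  and is_norm_eq_0_iff: "n x = 0 \<longleftrightarrow> x = 0"
  using n by (auto simp: is_norm_def)

lemma is_norm_minus: "n (- x) = n x"
  using is_norm_scale[of "-1" x] by simp

lemma is_norm_nonneg: "0 \<le> n x"
  using is_norm_triangle[of x "- x"] is_norm_minus[of x] is_norm_eq_0_iff[of 0] by simp

lemma is_norm_convex: "convex_on UNIV n"
  by (rule convex_onI) (use is_norm_triangle is_norm_scale in \<open>auto intro: order.trans[OF is_norm_triangle] simp: is_norm_scale\<close>)

lemma is_norm_continuous: "continuous_on UNIV n"
  by (rule convex_on_continuous[OF open_UNIV is_norm_convex])

lemma is_norm_measurable: "n \<in> borel_measurable borel"
  by (rule borel_measurable_continuous_onI[OF is_norm_continuous])

lemma is_norm_bounds_norm: "\<exists>c>0. \<forall>x. norm x \<le> c * n x"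
proof -
  let ?S = "sphere (0::'a) 1"
  have "?S \<noteq> {}"
    by (metis sphere_eq_empty not_one_less_zero)
  then obtain u where u: "u \<in> ?S" "\<And>y. y \<in> ?S \<Longrightarrow> n u \<le> n y"
    using continuous_attains_inf[OF compact_sphere _ continuous_on_subset[OF is_norm_continuous subset_UNIV]]
    by metis
  have pos: "0 < n u"
    using u(1) is_norm_nonneg[of u] is_norm_eq_0_iff[of u] by (force simp: less_le)
  have "norm x \<le> 1 / n u * n x" for x
  proof (cases "x = 0")
    case False
    then have "n u \<le> n ((1 / norm x) *\<^sub>R x)"
      by (intro u) simp
    with False pos show ?thesis
      by (simp add: is_norm_scale field_simps)
  qed (use pos is_norm_nonneg[of x] in simp)
  with pos show ?thesis
    by (intro exI[of _ "1 / n u"]) auto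
qed

text \<open>
  Jensen's inequality: the mean of \<open>(f, n f)\<close> lies in the epigraph of \<open>n\<close>, which is convex.
\<close>

lemma is_norm_integral_le:
  assumes "prob_space M" "integrable M f" "integrable M (\<lambda>x. n (f x))"
  shows "n (integral\<^sup>L M f) \<le> (\<integral>x. n (f x) \<partial>M)"
proof -
  have "integrable M (\<lambda>x. (f x, 0) + (0, n (f x)))"
    using assms(2,3) by (intro Bochner_Integration.integrable_add
      integrable_bounded_linear[OF bounded_linear_Pair[OF bounded_linear_ident bounded_linear_zero]]
      integrable_bounded_linear[OF bounded_linear_Pair[OF bounded_linear_zero bounded_linear_ident]])
  then have int: "integrable M (\<lambda>x. (f x, n (f x)))"
    by simp
  have "convex (epigraph UNIV n)"
    using is_norm_convex by (simp add: convex_epigraph)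
  then have "integral\<^sup>L M (\<lambda>x. (f x, n (f x))) \<in> epigraph UNIV n"
    by (rule convex_integral_mem[OF assms(1) int]) (simp add: mem_epigraph)
  then show ?thesis
    unfolding epigraph_def using integral_fst[OF int] integral_snd[OF int] by auto
qed

end

section \<open>Realizing laws on atomless probability spaces\<close>

text \<open>
  Inclusion is required to be strict in probability, so that an event of a chain is determined by its
  probability.  For plain inclusion, events that differ by a null set would obstruct the
  insertion of a new event into a maximal chain.
\<close>

definition event_chain :: "'a measure \<Rightarrow> 'a set set \<Rightarrow> bool" where
  "event_chain M C \<longleftrightarrow> C \<subseteq> sets M \<and>
     (\<forall>A\<in>C. \<forall>B\<in>C. A = B \<or> A \<subseteq> B \<and> measure M A < measure M B \<or> B \<subseteq> A \<and> measure M B < measure M A)"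

text \<open>
  The events of probability at most \<open>t\<close> may form an uncountable chain, whose union need not be
  measurable.  Unless there are none, either one of them attains the supremum of the probabilities, and it is the largest, or a
  sequence approaching the supremum already has the same union.
\<close>

lemma (in prob_space) event_chain_lower_bound:
  assumes C: "event_chain M C" and "0 \<le> t"
  obtains A where "A \<in> events" "prob A \<le> t" "\<And>E. E \<in> C \<Longrightarrow> prob E \<le> t \<Longrightarrow> E \<subseteq> A"
    "\<And>E. E \<in> C \<Longrightarrow> t < prob E \<Longrightarrow> A \<subseteq> E"
proof -
  have ev: "\<And>A. A \<in> C \<Longrightarrow> A \<in> events"
    and lt: "\<And>A B. A \<in> C \<Longrightarrow> B \<in> C \<Longrightarrow> prob A < prob B \<Longrightarrow> A \<subseteq> B"
    and eq: "\<And>A B. A \<in> C \<Longrightarrow> B \<in> C \<Longrightarrow> prob A = prob B \<Longrightarrow> A = B"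
    using C unfolding event_chain_def by (blast, metis less_asym order_refl, metis less_irrefl)
  define L where "L = {E \<in> C. prob E \<le> t}"
  define s where "s = (SUP E\<in>L. prob E)"
  have bdd: "bdd_above (prob ` L)"
    by (auto simp: L_def intro!: bdd_aboveI2[of _ _ t])
  then have le_s: "prob E \<le> s" if "E \<in> L" for E
    unfolding s_def using that by (rule cSUP_upper2) simp
  consider "L = {}" | E where "E \<in> L" "prob E = s" | "L \<noteq> {}" "\<And>E. E \<in> L \<Longrightarrow> prob E < s"
    using le_s by (meson less_eq_real_def)
  then show ?thesis
  proof cases
    case 1
    with \<open>0 \<le> t\<close> show ?thesis
      by (intro that[of "{}"]) (auto simp: L_def)
  next
    case (2 E)
    show ?thesis
    proof (rule that[of E])
      fix D assume "D \<in> C" "prob D \<le> t"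
      then have "prob D \<le> prob E"
        using 2 le_s by (simp add: L_def)
      then show "D \<subseteq> E"
        using 2 \<open>D \<in> C\<close> lt[of D E] eq[of D E] by (auto simp: L_def less_le)
    qed (use 2 lt ev in \<open>auto simp: L_def\<close>)
  next
    case 3
    have "\<exists>E\<in>L. s - 1 / real (Suc n) < prob E" for n
      using less_cSUP_iff[OF 3(1) bdd, of "s - 1 / real (Suc n)"] by (simp add: s_def)
    then obtain F where F: "\<And>n. F n \<in> L" "\<And>n. s - 1 / real (Suc n) < prob (F n)"
      by metis
    have un: "A \<union> B \<in> L" if "A \<in> L" "B \<in> L" for A B
    proof -
      have "A \<subseteq> B \<or> B \<subseteq> A"
        using C that unfolding event_chain_def L_def by blast
      then show ?thesis
        using that by (auto simp: Un_absorb1 Un_absorb2)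
    qed
    define G where "G n = (\<Union>i\<le>n. F i)" for n
    have G: "G n \<in> L" for n
      by (induction n) (auto simp: G_def atMost_Suc F intro: un)
    have "incseq G"
      unfolding G_def incseq_def by (auto 0 3)
    show ?thesis
    proof (rule that[of "\<Union>n. G n"])
      show "(\<Union>n. G n) \<in> events"
        using G ev by (auto simp: L_def)
      have "(\<lambda>n. prob (G n)) \<longlonglongrightarrow> prob (\<Union>n. G n)"
        using G ev \<open>incseq G\<close> by (intro finite_Lim_measure_incseq) (auto simp: L_def)
      then show "prob (\<Union>n. G n) \<le> t"
        by (rule LIMSEQ_le_const2) (use G in \<open>auto simp: L_def\<close>)
    next
      fix E assume "E \<in> C" "prob E \<le> t"
      then have "prob E < s"
        using 3 by (auto simp: L_def)
      then obtain n where "1 / real (Suc n) < s - prob E"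
        using nat_approx_posE[of "s - prob E"] by auto
      with F(2)[of n] have "prob E < prob (F n)"
        by simp
      then have "E \<subseteq> F n"
        using F(1)[of n] \<open>E \<in> C\<close> lt by (auto simp: L_def)
      then show "E \<subseteq> (\<Union>n. G n)"
        by (force simp: G_def)
    next
      fix E assume "E \<in> C" "t < prob E"
      then show "(\<Union>n. G n) \<subseteq> E"
        using G lt by (fastforce simp: L_def)
    qed
  qed
qed

text \<open>
  The lower bound for the chain of complements.
\<close>

lemma (in prob_space) event_chain_upper_bound:
  assumes C: "event_chain M C" and "t \<le> 1"
  obtains B where "B \<in> events" "t \<le> prob B" "\<And>E. E \<in> C \<Longrightarrow> t \<le> prob E \<Longrightarrow> B \<subseteq> E"
proof -
  have ev: "\<And>A. A \<in> C \<Longrightarrow> A \<in> events"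
    using C by (auto simp: event_chain_def)
  have "event_chain M ((\<lambda>E. space M - E) ` C)"
    unfolding event_chain_def
  proof (intro conjI ballI; (elim imageE; hypsubst)?)
    show "(\<lambda>E. space M - E) ` C \<subseteq> events"
      using ev by auto
    fix A B assume "A \<in> C" "B \<in> C"
    moreover from this have "A = B \<or> A \<subseteq> B \<and> prob A < prob B \<or> B \<subseteq> A \<and> prob B < prob A"
      using C by (auto simp: event_chain_def)
    ultimately show "space M - A = space M - B
        \<or> space M - A \<subseteq> space M - B \<and> prob (space M - A) < prob (space M - B)
        \<or> space M - B \<subseteq> space M - A \<and> prob (space M - B) < prob (space M - A)"
      using ev by (auto simp: prob_compl)
  qed
  then obtain A where A: "A \<in> events" "prob A \<le> 1 - t"
    "\<And>E. E \<in> (\<lambda>E. space M - E) ` C \<Longrightarrow> prob E \<le> 1 - t \<Longrightarrow> E \<subseteq> A"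
    using \<open>t \<le> 1\<close> by (elim event_chain_lower_bound[where t = "1 - t"]) auto
  show ?thesis
  proof (rule that[of "space M - A"])
    fix E assume "E \<in> C" "t \<le> prob E"
    then have "space M - E \<subseteq> A"
      using ev by (intro A) (auto simp: prob_compl)
    then show "space M - A \<subseteq> E"
      by auto
  qed (use A in \<open>auto simp: prob_compl\<close>)
qed

text \<open>
  A maximal chain of events attains every probability \<open>t\<close>.  Otherwise take bounds \<open>A\<close> and \<open>B\<close> for the
  parts of the chain below and above \<open>t\<close>.  If one of them has probability \<open>t\<close>, it can be added to the
  chain; if not, atomlessness provides an event strictly between \<open>A\<close> and \<open>B\<close>, which can be added.
\<close>

lemma (in atomless_prob_space) increasing_events:
  obtains E :: "real \<Rightarrow> 'a set"
  where "\<And>t. t \<in> {0..1} \<Longrightarrow> E t \<in> events" "\<And>t. t \<in> {0..1} \<Longrightarrow> prob (E t) = t"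
    "\<And>s t. s \<in> {0..1} \<Longrightarrow> t \<in> {0..1} \<Longrightarrow> s \<le> t \<Longrightarrow> E s \<subseteq> E t"
proof -
  define P where "P A B \<longleftrightarrow> A \<subseteq> B \<and> prob A < prob B" for A B
  obtain C where C: "pred_on.maxchain events P C"
    using pred_on.Hausdorff by blast
  have chain: "event_chain M C"
    using C unfolding pred_on.maxchain_def pred_on.chain_def event_chain_def P_def
    by (auto 0 3)
  have maximal: "D \<in> C" if "D \<in> events" "\<And>E. E \<in> C \<Longrightarrow> P E D \<or> P D E" for D
  proof (rule ccontr)
    assume "D \<notin> C"
    have "pred_on.chain events P (insert D C)"
      using C that unfolding pred_on.maxchain_def pred_on.chain_def by blast
    with \<open>D \<notin> C\<close> C show False
      unfolding pred_on.maxchain_def by blast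
  qed
  have "\<exists>E\<in>C. prob E = t" if t: "t \<in> {0..1}" for t
  proof (rule ccontr)
    assume none: "\<not> (\<exists>E\<in>C. prob E = t)"
    obtain A where A: "A \<in> events" "prob A \<le> t" "\<And>E. E \<in> C \<Longrightarrow> prob E \<le> t \<Longrightarrow> E \<subseteq> A"
      "\<And>E. E \<in> C \<Longrightarrow> t < prob E \<Longrightarrow> A \<subseteq> E"
      using t by (elim event_chain_lower_bound[OF chain, of t, rotated]) auto
    obtain B' where B': "B' \<in> events" "t \<le> prob B'" "\<And>E. E \<in> C \<Longrightarrow> t \<le> prob E \<Longrightarrow> B' \<subseteq> E"
      using t by (elim event_chain_upper_bound[OF chain, of t, rotated]) auto
    \<comment> \<open>The upper bound need not contain \<open>A\<close>; the union does, and it is still an upper bound.\<close>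
    define B where "B = A \<union> B'"
    have "prob B' \<le> prob B"
      unfolding B_def using A B' by (intro finite_measure_mono) auto
    then have B: "B \<in> events" "t \<le> prob B" "A \<subseteq> B"
      using A B' by (auto simp: B_def)
    have below: "E \<subseteq> A \<and> prob E \<le> prob A" if "E \<in> C" "prob E < t" for E
      using A(3)[OF that(1) less_imp_le[OF that(2)]] finite_measure_mono[OF _ A(1)] by blast
    have above: "B \<subseteq> E \<and> prob B \<le> prob E" if "E \<in> C" "t < prob E" for E
      using A(4)[of E] B'(3)[of E] B that chain by (auto intro!: finite_measure_mono simp: B_def event_chain_def)
    have split: "prob E < t \<or> t < prob E" if "E \<in> C" for E
      using none that by force
    show False
    proof (cases "prob A = t \<or> prob B = t")
      case True
      then obtain D where D: "D = A \<or> D = B" "prob D = t"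
        by blast
      have "D \<in> C"
      proof (rule maximal)
        fix E assume "E \<in> C"
        with split[of E] below[of E] above[of E] D B show "P E D \<or> P D E"
          unfolding P_def by auto
      qed (use A B D in auto)
      with none D show False
        by blast
    next
      case False
      with A B have *: "prob A < t" "t < prob B"
        by auto
      then have "0 < emeasure M (B - A)"
        using A B by (simp add: emeasure_eq_measure finite_measure_Diff)
      then obtain X where X: "X \<in> events" "X \<subseteq> B - A" "0 < emeasure M X" "emeasure M X < emeasure M (B - A)"
        using atomless[of "B - A"] A B by auto
      have "prob (A \<union> X) = prob A + prob X"
        using A X by (intro finite_measure_Union) auto
      with X A B have D: "prob A < prob (A \<union> X)" "prob (A \<union> X) < prob B"
        by (auto simp: emeasure_eq_measure finite_measure_Diff ennreal_less_iff)
      have "A \<union> X \<in> C"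
      proof (rule maximal)
        fix E assume "E \<in> C"
        with split[of E] below[of E] above[of E] D B X show "P E (A \<union> X) \<or> P (A \<union> X) E"
          unfolding P_def by fastforce
      qed (use A X in auto)
      with split[of "A \<union> X"] below[of "A \<union> X"] above[of "A \<union> X"] D show False
        by auto
    qed
  qed
  then obtain E where E: "\<And>t. t \<in> {0..1} \<Longrightarrow> E t \<in> C" "\<And>t. t \<in> {0..1} \<Longrightarrow> prob (E t) = t"
    by metis
  show ?thesis
  proof (rule that[of E])
    fix s t :: real assume "s \<in> {0..1}" "t \<in> {0..1}" "s \<le> t"
    then show "E s \<subseteq> E t"
      using E chain unfolding event_chain_def by (metis dual_order.refl less_le_not_le)
  qed (use E chain in \<open>auto simp: event_chain_def\<close>)
qed

text \<open>
  \<open>U \<omega>\<close> is the level at which the outcome enters the increasing family of events.  Only rational levels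
  are used, which makes \<open>U\<close> measurable.
\<close>

lemma (in atomless_prob_space) uniform_variable:
  obtains U :: "'a \<Rightarrow> real" where "U \<in> borel_measurable M"
    "\<And>x. x \<in> {0..1} \<Longrightarrow> prob {\<omega>\<in>space M. U \<omega> < x} = x"
    "\<And>x. x \<in> {0..1} \<Longrightarrow> prob {\<omega>\<in>space M. U \<omega> \<le> x} = x"
proof -
  obtain E :: "real \<Rightarrow> 'a set"
    where E[measurable]: "\<And>t. t \<in> {0..1} \<Longrightarrow> E t \<in> events"
    and E_prob: "\<And>t. t \<in> {0..1} \<Longrightarrow> prob (E t) = t"
    and E_mono: "\<And>s t. s \<in> {0..1} \<Longrightarrow> t \<in> {0..1} \<Longrightarrow> s \<le> t \<Longrightarrow> E s \<subseteq> E t"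
    by (rule increasing_events) blast
  define T where "T \<omega> = insert 1 {q \<in> \<rat> \<inter> {0..1}. \<omega> \<in> E q}" for \<omega>
  define U where "U \<omega> = Inf (T \<omega>)" for \<omega>
  have "bdd_below (T \<omega>)" "T \<omega> \<noteq> {}" for \<omega>
    by (auto simp: T_def intro!: bdd_belowI[of _ 0])
  then have U_less: "U \<omega> < x \<longleftrightarrow> (\<exists>q\<in>T \<omega>. q < x)" for \<omega> x
    by (simp add: U_def cInf_less_iff)
  have less_eq: "{\<omega>\<in>space M. U \<omega> < x} = (\<Union>q\<in>\<rat> \<inter> {0..1} \<inter> {..<x}. E q)" if "x \<le> 1" for x
  proof -
    have sub: "E q \<subseteq> space M" if "0 \<le> q" "q < x" for q
      using that \<open>x \<le> 1\<close> by (intro sets.sets_into_space E) simp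
    show ?thesis
      using that by (auto simp: U_less T_def dest: subsetD[OF sub])
  qed
  have less_sets: "{\<omega>\<in>space M. U \<omega> < x} \<in> events" for x
  proof (cases "x \<le> 1")
    case True
    show ?thesis
      unfolding less_eq[OF True] by (intro sets.countable_UN'' countable_subset[OF _ countable_rat]) auto
  next
    case False
    then have "{\<omega>\<in>space M. U \<omega> < x} = space M"
      by (auto simp: U_less T_def)
    then show ?thesis
      by simp
  qed
  then have U[measurable]: "U \<in> borel_measurable M"
    by (simp add: borel_measurable_iff_less)
  have less: "prob {\<omega>\<in>space M. U \<omega> < x} = x" if x: "x \<in> {0..1}" for x
  proof (rule antisym)
    have "{\<omega>\<in>space M. U \<omega> < x} \<subseteq> E x"
      using x E_mono[of _ x] by (subst less_eq) fastforce+
    then show "prob {\<omega>\<in>space M. U \<omega> < x} \<le> x"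
      using finite_measure_mono[of _ "E x"] E[of x] E_prob[of x] x by metis
    show "x \<le> prob {\<omega>\<in>space M. U \<omega> < x}"
    proof (rule dense_le)
      fix y assume "y < x"
      show "y \<le> prob {\<omega>\<in>space M. U \<omega> < x}"
      proof (cases "y < 0")
        case False
        obtain q where q: "q \<in> \<rat>" "y < q" "q < x"
          using Rats_dense_in_real[OF \<open>y < x\<close>] by auto
        with False x have "E q \<subseteq> {\<omega>\<in>space M. U \<omega> < x}"
          by (subst less_eq) auto
        then have "prob (E q) \<le> prob {\<omega>\<in>space M. U \<omega> < x}"
          by (rule finite_measure_mono) (rule less_sets)
        with E_prob[of q] q False x show ?thesis
          by auto
      qed (use measure_nonneg[of M] in \<open>auto intro: order.trans[OF less_imp_le]\<close>)
    qed
  qed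
  have le: "prob {\<omega>\<in>space M. U \<omega> \<le> x} = x" if x: "x \<in> {0..1}" for x
  proof (rule antisym)
    show "prob {\<omega>\<in>space M. U \<omega> \<le> x} \<le> x"
    proof (rule dense_ge)
      fix y assume "x < y"
      show "prob {\<omega>\<in>space M. U \<omega> \<le> x} \<le> y"
      proof (cases "y \<le> 1")
        case True
        have "prob {\<omega>\<in>space M. U \<omega> \<le> x} \<le> prob {\<omega>\<in>space M. U \<omega> < y}"
          using \<open>x < y\<close> less_sets by (intro finite_measure_mono) auto
        with less[of y] True x \<open>x < y\<close> show ?thesis
          by auto
      qed (use prob_le_1 in \<open>auto intro: order.trans[OF prob_le_1]\<close>)
    qed
    have "prob {\<omega>\<in>space M. U \<omega> < x} \<le> prob {\<omega>\<in>space M. U \<omega> \<le> x}"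
      by (intro finite_measure_mono) auto
    then show "x \<le> prob {\<omega>\<in>space M. U \<omega> \<le> x}"
      using less[OF x] by simp
  qed
  show ?thesis
    using that[OF U less le] .
qed

text \<open>
  The quantile transform of a uniform variable.
\<close>

lemma (in atomless_prob_space) real_distribution_realized:
  assumes "real_distribution \<nu>"
  obtains X where "X \<in> borel_measurable M" "distr M borel X = \<nu>"
proof -
  interpret \<nu>: real_distribution \<nu> by fact
  interpret cdf_distribution \<nu> ..
  obtain U where U[measurable]: "U \<in> borel_measurable M"
    and less: "\<And>x. x \<in> {0..1} \<Longrightarrow> prob {\<omega>\<in>space M. U \<omega> < x} = x"
    and le: "\<And>x. x \<in> {0..1} \<Longrightarrow> prob {\<omega>\<in>space M. U \<omega> \<le> x} = x"
    by (rule uniform_variable) blast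
  have "AE \<omega> in M. U \<omega> < 1"
    using prob_Collect_eq_1[of "\<lambda>\<omega>. U \<omega> < 1"] less[of 1] by simp
  moreover have "AE \<omega> in M. \<not> U \<omega> \<le> 0"
    using prob_Collect_eq_0[of "\<lambda>\<omega>. U \<omega> \<le> 0"] le[of 0] by simp
  ultimately have U_AE: "AE \<omega> in M. U \<omega> \<in> {0<..<1}"
    by eventually_elim simp
  define J where "J u = (if u \<in> {0<..<1} then I u else 0)" for u
  have [measurable]: "J \<in> borel_measurable borel"
    using measurable_CI unfolding J_def
    by (intro measurable_If_restrict_space_iff[THEN iffD2] conjI) (simp_all only: Collect_mem_eq, simp_all)
  define X where "X \<omega> = J (U \<omega>)" for \<omega>
  have X[measurable]: "X \<in> borel_measurable M"
    unfolding X_def by measurable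
  have "distr M borel X = \<nu>"
  proof (rule cdf_unique)
    show "real_distribution (distr M borel X)"
      by (rule real_distribution_distr) simp
    show "cdf (distr M borel X) = C"
    proof
      fix x
      have "cdf (distr M borel X) x = prob {\<omega>\<in>space M. X \<omega> \<le> x}"
      proof -
        have "X -` {..x} \<inter> space M = {\<omega>\<in>space M. X \<omega> \<le> x}"
          by blast
        then show ?thesis
          unfolding cdf_def by (subst measure_distr[OF X]) simp_all
      qed
      also have "\<dots> = prob {\<omega>\<in>space M. U \<omega> \<le> C x}"
      proof (rule finite_measure_eq_AE)
        show "AE \<omega> in M. \<omega> \<in> {\<omega>\<in>space M. X \<omega> \<le> x} \<longleftrightarrow> \<omega> \<in> {\<omega>\<in>space M. U \<omega> \<le> C x}"
          \<comment> \<open>The rule is used from right to left: its right-hand side contains an instance of its left-hand side.\<close>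
          using U_AE by eventually_elim (simp add: X_def J_def pseudoinverse[symmetric])
      qed simp_all
      also have "\<dots> = C x"
        using \<nu>.cdf_nonneg \<nu>.cdf_bounded_prob by (intro le) auto
      finally show "cdf (distr M borel X) x = C x" .
    qed
  qed fact
  with X show ?thesis
    by (rule that)
qed

section \<open>Rotations of the unit interval\<close>

lemma emeasure_lborel_translate:
  assumes "A \<in> sets borel"
  shows "emeasure lborel ((+) c -` A) = emeasure lborel (A :: real set)"
proof -
  have "emeasure lborel A = emeasure (distr lborel borel ((+) c)) A"
    by (simp add: lborel_distr_plus)
  also have "\<dots> = emeasure lborel ((+) c -` A)"
    using assms by (subst emeasure_distr) auto
  finally show ?thesis ..
qed

text \<open>
  The two arcs that the rotation moves are translated by \<open>s\<close> and by \<open>s - 1\<close>.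
\<close>

lemma emeasure_rotation_unit_interval:
  fixes A :: "real set"
  assumes [measurable]: "A \<in> sets borel" and s: "0 \<le> s" "s \<le> 1"
  shows "emeasure lborel {v \<in> {0..<1}. frac (v + s) \<in> A} = emeasure lborel {v \<in> {0..<1}. v \<in> A}"
proof -
  have frac: "frac (v + s) = (if v + s < 1 then v + s else v + s - 1)" if "v \<in> {0..<1}" for v
    using that s by (auto simp: frac_unique_iff)
  have "{v \<in> {0..<1}. frac (v + s) \<in> A} = (+) s -` (A \<inter> {s..<1}) \<union> (+) (s - 1) -` (A \<inter> {0..<s})"
    (is "_ = ?A1 \<union> ?A2")
    using s by (auto simp: frac algebra_simps split: if_splits)
  also have "emeasure lborel \<dots> = emeasure lborel ?A1 + emeasure lborel ?A2"
    by (rule plus_emeasure[symmetric]) (auto intro!: measurable_sets_borel)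
  also have "\<dots> = emeasure lborel (A \<inter> {s..<1}) + emeasure lborel (A \<inter> {0..<s})"
    by (simp only: emeasure_lborel_translate[OF sets.Int[OF assms(1)]] atLeastLessThan_borel)
  also have "\<dots> = emeasure lborel (A \<inter> {s..<1} \<union> A \<inter> {0..<s})"
    by (rule plus_emeasure) auto
  also have "A \<inter> {s..<1} \<union> A \<inter> {0..<s} = {v \<in> {0..<1}. v \<in> A}"
    using s by auto
  finally show ?thesis .
qed

lemma sum_mod_rotate:
  fixes g :: "nat \<Rightarrow> 'a::ab_group_add"
  shows "(\<Sum>i<n. g ((k + i) mod n)) = (\<Sum>i<n. g i)"
proof (induction k)
  case (Suc k)
  have "(\<Sum>i<n. g ((Suc k + i) mod n)) + g (k mod n) = (\<Sum>i<Suc n. g ((k + i) mod n))"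
    by (subst sum.lessThan_Suc_shift) simp
  also have "\<dots> = (\<Sum>i<n. g ((k + i) mod n)) + g (k mod n)"
    by simp
  finally show ?case
    using Suc by simp
qed simp

text \<open>
  The rotations of \<open>v\<close> by multiples of \<open>1 / n\<close> visit each of the \<open>n\<close> cells of the grid exactly once, and \<open>h\<close> is
  at least its value at the left end of the cell.
\<close>

lemma sum_grid_le_sum_rotations:
  fixes h :: "real \<Rightarrow> real"
  assumes mono: "mono_on {0..<1} h" and v: "0 \<le> v" "v < 1" and n: "0 < n"
  shows "(\<Sum>j<n. h (real j / real n)) \<le> (\<Sum>i<n. h (frac (v + real i / real n)))"
proof -
  define k where "k = nat \<lfloor>real n * v\<rfloor>"
  have k: "real k \<le> real n * v" "real n * v < real k + 1"
    using v by (auto simp: k_def)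
  have "(\<Sum>j<n. h (real j / real n)) = (\<Sum>i<n. h (real ((k + i) mod n) / real n))"
    using sum_mod_rotate[of "\<lambda>j. h (real j / real n)" k n] by simp
  also have "\<dots> \<le> (\<Sum>i<n. h (frac (v + real i / real n)))"
  proof (rule sum_mono)
    fix i
    \<comment> \<open>\<open>q\<close> is the number of turns and \<open>r\<close> the cell in which the rotated point lands.\<close>
    define q r where "q = (k + i) div n" and "r = (k + i) mod n"
    have qr: "real k + real i = real q * real n + real r"
      unfolding q_def r_def of_nat_add[symmetric] of_nat_mult[symmetric] by simp
    have "r < n"
      using n by (simp add: r_def)
    have common: "v + real i / real n = (real n * v + real i) / real n"
      "real q + x / real n = (real q * real n + x) / real n" for x
      using n by (auto simp: field_simps)
    have lo: "real q + real r / real n \<le> v + real i / real n"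
      unfolding common using k(1) qr by (intro divide_right_mono) auto
    have "v + real i / real n < real q + (real r + 1) / real n"
      unfolding common using k(2) qr n by (intro divide_strict_right_mono) auto
    also have "\<dots> \<le> real q + 1"
      using \<open>r < n\<close> by (simp add: field_simps)
    finally have hi: "v + real i / real n < real q + 1" .
    have "0 \<le> real r / real n"
      by simp
    with lo have "real q \<le> v + real i / real n"
      by linarith
    with hi have "\<lfloor>v + real i / real n\<rfloor> = int q"
      by (intro floor_unique) auto
    then have fr: "frac (v + real i / real n) = v + real i / real n - real q"
      by (simp add: frac_def)
    show "h (real ((k + i) mod n) / real n) \<le> h (frac (v + real i / real n))"
    proof (rule mono_onD[OF mono])
      show "real ((k + i) mod n) / real n \<in> {0..<1}"
        using \<open>r < n\<close> by (simp add: r_def)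
      show "frac (v + real i / real n) \<in> {0..<1}"
        by (simp add: frac_lt_1)
      show "real ((k + i) mod n) / real n \<le> frac (v + real i / real n)"
        using lo unfolding fr r_def by simp
    qed
  qed
  finally show ?thesis .
qed

text \<open>
  On a cell, \<open>h\<close> is at most its value at the right end, which is the left end of the next cell.  The last
  cell has no successor and is left out of the integral, since \<open>h\<close> may be unbounded near \<open>1\<close>.
\<close>

lemma nn_integral_le_sum_grid:
  fixes h :: "real \<Rightarrow> real"
  assumes mono: "mono_on {0..<1} h" and nonneg: "\<And>v. 0 \<le> h v"
  shows "(\<integral>\<^sup>+v. ennreal (h v) * indicator {0..<1 - 1 / real (Suc m)} v \<partial>lborel)
    \<le> ennreal (1 / real (Suc m) * (\<Sum>j<Suc m. h (real j / real (Suc m))))"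
proof -
  let ?n = "real (Suc m)"
  let ?J = "\<lambda>i. {real i / ?n..<real (Suc i) / ?n}"
  have "(\<integral>\<^sup>+v. ennreal (h v) * indicator {0..<1 - 1 / ?n} v \<partial>lborel)
    \<le> (\<integral>\<^sup>+v. (\<Sum>i<m. ennreal (h (real (Suc i) / ?n)) * indicator (?J i) v) \<partial>lborel)"
  proof (rule nn_integral_mono)
    fix v :: real
    show "ennreal (h v) * indicator {0..<1 - 1 / ?n} v
      \<le> (\<Sum>i<m. ennreal (h (real (Suc i) / ?n)) * indicator (?J i) v)"
    proof (cases "v \<in> {0..<1 - 1 / ?n}")
      case True
      define i where "i = nat \<lfloor>?n * v\<rfloor>"
      have i: "real i \<le> ?n * v" "?n * v < real i + 1"
        using True by (auto simp: i_def)
      have "?n * v < real m"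
        using True by (simp add: field_simps)
      with i have "i < m"
        by linarith
      have v: "v \<in> ?J i"
        using i by (auto simp: field_simps)
      have "v < 1"
        using True by (auto intro: order.strict_trans2)
      then have "h v \<le> h (real (Suc i) / ?n)"
        using \<open>i < m\<close> True v by (intro mono_onD[OF mono]) (auto simp: field_simps)
      with v True have "ennreal (h v) * indicator {0..<1 - 1 / ?n} v \<le> ennreal (h (real (Suc i) / ?n)) * indicator (?J i) v"
        by (simp add: ennreal_leI)
      also have "\<dots> \<le> (\<Sum>i<m. ennreal (h (real (Suc i) / ?n)) * indicator (?J i) v)"
        using \<open>i < m\<close> by (intro member_le_sum[where f = "\<lambda>i. ennreal (h (real (Suc i) / ?n)) * indicator (?J i) v"]) auto
      finally show ?thesis .
    qed simp
  qed
  also have "\<dots> = (\<Sum>i<m. ennreal (h (real (Suc i) / ?n)) * emeasure lborel (?J i))"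
    by (subst nn_integral_sum) (auto intro!: sum.cong nn_integral_cmult_indicator)
  also have "\<dots> = (\<Sum>i<m. ennreal (1 / ?n * h (real (Suc i) / ?n)))"
  proof (rule sum.cong)
    fix i assume "i \<in> {..<m}"
    have "emeasure lborel (?J i) = ennreal (1 / ?n)"
      by (subst emeasure_lborel_Ico) (simp_all add: field_simps)
    then show "ennreal (h (real (Suc i) / ?n)) * emeasure lborel (?J i) = ennreal (1 / ?n * h (real (Suc i) / ?n))"
      by (subst ennreal_mult) (use nonneg in \<open>auto simp: mult.commute\<close>)
  qed simp
  also have "\<dots> = ennreal (\<Sum>i<m. 1 / ?n * h (real (Suc i) / ?n))"
    using nonneg by (intro sum_ennreal) simp
  also have "\<dots> \<le> ennreal (1 / ?n * (\<Sum>j<Suc m. h (real j / ?n)))"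
    unfolding sum.lessThan_Suc_shift using nonneg[of 0]
    by (intro ennreal_leI) (simp add: sum_distrib_left distrib_left)
  finally show ?thesis .
qed

text \<open>
  The bound \<open>d\<close> may be strictly below the integral, which may be infinite; therefore the statement is a
  one-sided estimate, proved by monotone convergence, and not a limit of Riemann sums.
\<close>

lemma eventually_le_grid_average:
  fixes h :: "real \<Rightarrow> real"
  assumes mono: "mono_on {0..<1} h" and nonneg: "\<And>v. 0 \<le> h v" and [measurable]: "h \<in> borel_measurable borel"
    and d: "ennreal d \<le> (\<integral>\<^sup>+v. ennreal (h v) * indicator {0..<1} v \<partial>lborel)" and \<delta>: "0 < \<delta>"
  shows "eventually (\<lambda>m. d \<le> 1 / real (Suc m) * (\<Sum>j<Suc m. h (real j / real (Suc m))) + \<delta>) sequentially"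
proof (cases "d \<le> \<delta>")
  case True
  have "0 \<le> 1 / real (Suc m) * (\<Sum>j<Suc m. h (real j / real (Suc m)))" for m
    using nonneg by (intro mult_nonneg_nonneg sum_nonneg) auto
  with True show ?thesis
    by (intro always_eventually allI) (smt (verit))
next
  case False
  let ?f = "\<lambda>m v. ennreal (h v) * indicator {0..<1 - 1 / real (Suc m)} v"
  have inc: "incseq ?f"
  proof (intro incseq_SucI le_funI mult_left_mono)
    fix m v
    have "1 / real (Suc (Suc m)) \<le> 1 / real (Suc m)"
      by (simp add: frac_le)
    then show "(indicator {0..<1 - 1 / real (Suc m)} v :: ennreal) \<le> indicator {0..<1 - 1 / real (Suc (Suc m))} v"
      by (auto simp: indicator_def)
  qed simp
  have "(SUP m. ?f m v) = ennreal (h v) * indicator {0..<1} v" for v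
  proof (rule antisym)
    show "(SUP m. ?f m v) \<le> ennreal (h v) * indicator {0..<1} v"
      by (intro SUP_least mult_left_mono) (auto simp: indicator_def intro: order.strict_trans2)
    show "ennreal (h v) * indicator {0..<1} v \<le> (SUP m. ?f m v)"
    proof (cases "v \<in> {0..<1}")
      case True
      then obtain m where "1 / real (Suc m) < 1 - v"
        using nat_approx_posE[of "1 - v"] by auto
      with True have "v \<in> {0..<1 - 1 / real (Suc m)}"
        by simp
      with True have "ennreal (h v) * indicator {0..<1} v = ?f m v"
        by (simp only: indicator_simps)
      also have "\<dots> \<le> (SUP m. ?f m v)"
        by (rule SUP_upper) simp
      finally show ?thesis .
    qed simp
  qed
  then have "(\<integral>\<^sup>+v. ennreal (h v) * indicator {0..<1} v \<partial>lborel) = (SUP m. \<integral>\<^sup>+v. ?f m v \<partial>lborel)"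
    using nn_integral_monotone_convergence_SUP[OF inc, of lborel] by simp
  moreover have "ennreal (d - \<delta>) < ennreal d"
    using False \<delta> by (intro ennreal_lessI) auto
  ultimately have "ennreal (d - \<delta>) < (SUP m. \<integral>\<^sup>+v. ?f m v \<partial>lborel)"
    using d by (simp only: order.strict_trans2)
  then obtain m where m: "ennreal (d - \<delta>) < (\<integral>\<^sup>+v. ?f m v \<partial>lborel)"
    by (auto simp only: less_SUP_iff)
  have "d \<le> 1 / real (Suc k) * (\<Sum>j<Suc k. h (real j / real (Suc k))) + \<delta>" if "m \<le> k" for k
  proof -
    have "ennreal (d - \<delta>) < (\<integral>\<^sup>+v. ?f m v \<partial>lborel)"
      by (rule m)
    also have "\<dots> \<le> (\<integral>\<^sup>+v. ?f k v \<partial>lborel)"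
      by (intro nn_integral_mono le_funD[OF incseqD[OF inc that]])
    also have "\<dots> \<le> ennreal (1 / real (Suc k) * (\<Sum>j<Suc k. h (real j / real (Suc k))))"
      by (rule nn_integral_le_sum_grid[OF mono nonneg])
    finally have "d - \<delta> < 1 / real (Suc k) * (\<Sum>j<Suc k. h (real j / real (Suc k)))"
      using False by (simp add: ennreal_less_iff)
    then show ?thesis
      by simp
  qed
  then show ?thesis
    by (auto simp: eventually_sequentially)
qed

section \<open>Risk of mixtures and of their means\<close>

text \<open>
  At \<open>0\<close> the pseudo-inverse of the distribution function is an infimum over all reals; the value \<open>0\<close> there
  keeps the function monotone and nonnegative on the half-open interval.
\<close>

lemma quantile_function:
  assumes "real_distribution \<nu>" and neg: "emeasure \<nu> {..<0} = 0"
  obtains h :: "real \<Rightarrow> real" where "h \<in> borel_measurable borel" "mono_on {0..<1} h" "\<And>v. 0 \<le> h v"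
    "\<And>A. A \<in> sets borel \<Longrightarrow> emeasure lborel {v \<in> {0..<1}. h v \<in> A} = emeasure \<nu> A"
proof -
  interpret \<nu>: real_distribution \<nu> by fact
  interpret cdf_distribution \<nu> ..
  define h where "h v = (if v \<in> {0<..<1} then I v else 0)" for v
  have I_nonneg: "0 \<le> I v" if "v \<in> {0<..<1}" for v
  proof (rule ccontr)
    assume neg_I: "\<not> 0 \<le> I v"
    define a where "a = I v"
    have "a < 0"
      using neg_I by (simp add: a_def)
    have "v \<le> C a"
      using that pseudoinverse[of v a] by (simp add: a_def)
    also have "C a \<le> measure \<nu> {..<0}"
      using \<open>a < 0\<close> unfolding cdf_def by (intro \<nu>.finite_measure_mono) auto
    also have "\<dots> = 0"
      using neg by (simp add: measure_def)
    finally show False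
      using that by simp
  qed
  have meas: "h \<in> borel_measurable borel"
    using measurable_CI unfolding h_def
    by (intro measurable_If_restrict_space_iff[THEN iffD2] conjI) (simp_all only: Collect_mem_eq, simp_all)
  show ?thesis
  proof (rule that[OF meas])
    show "0 \<le> h v" for v
      using I_nonneg by (simp add: h_def)
    show "mono_on {0..<1} h"
    proof (rule mono_onI)
      fix u v :: real assume "u \<in> {0..<1}" "v \<in> {0..<1}" "u \<le> v"
      then show "h u \<le> h v"
        using mono_onD[OF mono_I, of u v] I_nonneg[of v] by (cases "u = 0") (auto simp: h_def)
    qed
    fix A :: "real set" assume A: "A \<in> sets borel"
    have "emeasure \<nu> A = emeasure (distr (restrict_space lborel {0<..<1::real}) borel I) A"
      by (simp add: distr_I_eq_M)
    also have "\<dots> = emeasure (restrict_space lborel {0<..<1::real}) (I -` A \<inter> {0<..<1})"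
      using A by (subst emeasure_distr) (simp_all add: space_restrict_space cong: measurable_cong_sets)
    also have "\<dots> = emeasure lborel (I -` A \<inter> {0<..<1})"
      by (rule emeasure_restrict_space) auto
    also have "I -` A \<inter> {0<..<1} = {v \<in> {0<..<1}. h v \<in> A}"
      by (auto simp: h_def)
    also have "emeasure lborel \<dots> = emeasure lborel {v \<in> {0..<1}. h v \<in> A}"
    proof (rule emeasure_eq_AE)
      show "AE v in lborel. v \<in> {v \<in> {0<..<1}. h v \<in> A} \<longleftrightarrow> v \<in> {v \<in> {0..<1}. h v \<in> A}"
        using AE_lborel_singleton[of 0] by eventually_elim auto
    qed (use meas A in measurable)
    finally show "emeasure lborel {v \<in> {0..<1}. h v \<in> A} = emeasure \<nu> A" ..
  qed
qed

text \<open>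
  The pair \<open>(L, V)\<close> is coded by a single real variable \<open>Y\<close> of density \<open>w k\<close> on the interval
  \<open>[e k, e k + 1)\<close>, where \<open>e\<close> numbers the labels: the integer part of \<open>Y\<close> gives the label and its fractional
  part the uniform variable.
\<close>

lemma (in atomless_prob_space) labelled_uniform_variable:
  fixes w :: "'i \<Rightarrow> real"
  assumes I: "finite I" and w: "\<And>k. k \<in> I \<Longrightarrow> 0 \<le> w k" "(\<Sum>k\<in>I. w k) = 1"
  obtains L :: "'a \<Rightarrow> 'i" and V :: "'a \<Rightarrow> real"
  where "L \<in> measurable M (count_space I)" "V \<in> borel_measurable M" "\<And>\<omega>. 0 \<le> V \<omega> \<and> V \<omega> < 1"
    "\<And>k A. k \<in> I \<Longrightarrow> A \<in> sets borel \<Longrightarrow>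
       emeasure M {\<omega> \<in> space M. L \<omega> = k \<and> V \<omega> \<in> A} = ennreal (w k) * emeasure lborel {v \<in> {0..<1}. v \<in> A}"
proof -
  have "I \<noteq> {}"
    using w by auto
  then obtain k0 where k0: "k0 \<in> I"
    by blast
  obtain e :: "'i \<Rightarrow> nat" where e: "inj_on e I"
    using finite_imp_inj_to_nat_seg[OF I] by metis
  define g where "g = (\<lambda>y::real. \<Sum>k\<in>I. ennreal (w k) * indicator {real (e k)..<real (e k) + 1} y)"
  have g[measurable]: "g \<in> borel_measurable borel"
    unfolding g_def by measurable
  define \<mu> where "\<mu> = density lborel g"
  have emeasure_\<mu>: "emeasure \<mu> B = (\<Sum>k\<in>I. ennreal (w k) * emeasure lborel (B \<inter> {real (e k)..<real (e k) + 1}))"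
    if [measurable]: "B \<in> sets borel" for B
  proof -
    have "emeasure \<mu> B = (\<integral>\<^sup>+y. g y * indicator B y \<partial>lborel)"
      unfolding \<mu>_def by (subst emeasure_density) auto
    also have "\<dots> = (\<integral>\<^sup>+y. (\<Sum>k\<in>I. ennreal (w k) * indicator (B \<inter> {real (e k)..<real (e k) + 1}) y) \<partial>lborel)"
      unfolding g_def by (auto simp: sum_distrib_right indicator_def intro!: nn_integral_cong sum.cong)
    also have "\<dots> = (\<Sum>k\<in>I. ennreal (w k) * emeasure lborel (B \<inter> {real (e k)..<real (e k) + 1}))"
      by (subst nn_integral_sum) (auto intro!: sum.cong nn_integral_cmult_indicator)
    finally show ?thesis .
  qed
  have "emeasure \<mu> UNIV = 1"
    by (subst emeasure_\<mu>) (use w in \<open>auto simp: sum_ennreal\<close>)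
  then have "prob_space \<mu>"
    by (intro prob_spaceI) (simp add: \<mu>_def)
  then have "real_distribution \<mu>"
    by (simp add: real_distribution_def real_distribution_axioms_def \<mu>_def)
  then obtain Y where Y[measurable]: "Y \<in> borel_measurable M" and Y_distr: "distr M borel Y = \<mu>"
    by (rule real_distribution_realized)
  \<comment> \<open>The default case occurs only on a null set.\<close>
  define G where "G n = (if n \<in> e ` I then inv_into I e n else k0)" for n
  have G: "G n \<in> I" for n
    using k0 by (auto simp: G_def inv_into_into)
  have G_e: "G n = k \<longleftrightarrow> n = e k" if "n \<in> e ` I" "k \<in> I" for n k
    using that e by (auto simp: G_def)
  define L where "L \<omega> = G (nat \<lfloor>Y \<omega>\<rfloor>)" for \<omega>
  define V where "V \<omega> = frac (Y \<omega>)" for \<omega>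
  have "(\<lambda>\<omega>. nat \<lfloor>Y \<omega>\<rfloor>) \<in> measurable M (count_space UNIV)"
    by measurable
  then have L: "L \<in> measurable M (count_space I)"
    unfolding L_def by (rule measurable_compose) (use G in simp)
  have frac[measurable]: "frac \<in> borel_measurable (borel :: real measure)"
    unfolding frac_def[abs_def] by measurable
  have V[measurable]: "V \<in> borel_measurable M"
    unfolding V_def by measurable
  show ?thesis
  proof (rule that[OF L V])
    show "0 \<le> V \<omega> \<and> V \<omega> < 1" for \<omega>
      by (simp add: V_def frac_lt_1)
    fix k and A :: "real set" assume k: "k \<in> I" and A[measurable]: "A \<in> sets borel"
    define B where "B = {y. G (nat \<lfloor>y\<rfloor>) = k \<and> frac y \<in> A}"
    have "{y \<in> space borel. G (nat \<lfloor>y\<rfloor>) = k \<and> frac y \<in> A} \<in> sets (borel :: real measure)"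
      by measurable
    then have B[measurable]: "B \<in> sets borel"
      by (simp add: B_def)
    have B_Int: "B \<inter> {real (e l)..<real (e l) + 1} = (if l = k then (+) (- real (e k)) -` (A \<inter> {0..<1}) else {})"
      if "l \<in> I" for l
    proof -
      have "\<lfloor>y\<rfloor> = int (e l)" if "y \<in> {real (e l)..<real (e l) + 1}" for y
        using that by (intro floor_unique) auto
      moreover have "G (e l) = k \<longleftrightarrow> l = k"
        using G_e[of "e l" k] k \<open>l \<in> I\<close> e by (auto dest: inj_onD)
      ultimately show ?thesis
        by (auto simp: B_def frac_def)
    qed
    have "{\<omega> \<in> space M. L \<omega> = k \<and> V \<omega> \<in> A} = Y -` B \<inter> space M"
      by (auto simp: L_def V_def B_def)
    also have "emeasure M \<dots> = emeasure \<mu> B"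
      unfolding Y_distr[symmetric] by (rule emeasure_distr[symmetric]) measurable
    also have "\<dots> = (\<Sum>l\<in>I. if l = k then ennreal (w k) * emeasure lborel ((+) (- real (e k)) -` (A \<inter> {0..<1})) else 0)"
      by (subst emeasure_\<mu>[OF B]) (auto simp: B_Int intro!: sum.cong)
    also have "\<dots> = ennreal (w k) * emeasure lborel (A \<inter> {0..<1})"
      using k I by (simp add: emeasure_lborel_translate del: vimage_Int)
    also have "A \<inter> {0..<1} = {v \<in> {0..<1}. v \<in> A}"
      by auto
    finally show "emeasure M {\<omega> \<in> space M. L \<omega> = k \<and> V \<omega> \<in> A} = ennreal (w k) * emeasure lborel {v \<in> {0..<1}. v \<in> A}" .
  qed
qed

context law_invariant_coherent_risk
begin

text \<open>
  The value on a law does not depend on the random variable that represents it.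
\<close>

lemma risk_of_law_eq:
  assumes "X \<in> nonneg_rv S"
  shows "risk_of_law S \<rho> (distr S borel X) = \<rho> X"
proof -
  let ?P = "\<lambda>Y. Y \<in> nonneg_rv S \<and> distr S borel Y = distr S borel X"
  have "?P (SOME Y. ?P Y)"
    by (rule someI[of ?P X]) (use assms in simp)
  then show ?thesis
    unfolding risk_of_law_def using assms by (intro law_invariance) auto
qed

lemma nonneg_rv_sum:
  assumes "\<And>j. j \<in> J \<Longrightarrow> X j \<in> nonneg_rv S"
  shows "(\<lambda>\<omega>. \<Sum>j\<in>J. X j \<omega>) \<in> nonneg_rv S"
proof -
  have "(\<lambda>\<omega>. \<Sum>j\<in>J. X j \<omega>) \<in> borel_measurable S"
    by (rule borel_measurable_sum) (use assms in \<open>simp add: nonneg_rv_def\<close>)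
  then show ?thesis
    using assms by (auto simp: nonneg_rv_def intro!: sum_nonneg)
qed

lemma risk_sum_le:
  assumes "finite J" "\<And>j. j \<in> J \<Longrightarrow> X j \<in> nonneg_rv S"
  shows "\<rho> (\<lambda>\<omega>. \<Sum>j\<in>J. X j \<omega>) \<le> (\<Sum>j\<in>J. \<rho> (X j))"
  using assms
proof (induction J rule: finite_induct)
  case (insert j J)
  have "(\<lambda>\<omega>. \<Sum>j\<in>J. X j \<omega>) \<in> nonneg_rv S"
    using insert.prems by (intro nonneg_rv_sum) auto
  then have "\<rho> (\<lambda>\<omega>. X j \<omega> + (\<Sum>j\<in>J. X j \<omega>)) \<le> \<rho> (X j) + \<rho> (\<lambda>\<omega>. \<Sum>j\<in>J. X j \<omega>)"
    using insert by (intro subadditivity) auto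
  also have "\<dots> \<le> \<rho> (X j) + (\<Sum>j\<in>J. \<rho> (X j))"
    using insert by (intro add_left_mono) auto
  finally show ?case
    using insert by simp
qed (simp add: risk_zero)

text \<open>
  Monotonicity of the risk under conditional expectation, in terms of laws: \<open>\<mu>\<close> is the mixture of the
  \<open>\<nu> k\<close>, and \<open>\<mu>'\<close> results from concentrating each component at a point \<open>d k\<close> not above its mean.  The
  average \<open>Z / n\<close> of \<open>n\<close> rotated copies of a variable with law \<open>\<mu>\<close> dominates, up to \<open>\<delta>\<close>, a variable with
  law \<open>\<mu>'\<close>.
\<close>

lemma risk_of_law_mixture_of_means_le:
  fixes \<nu> :: "'i \<Rightarrow> real measure" and w d :: "'i \<Rightarrow> real"
  assumes I: "finite I" and w: "\<And>k. k \<in> I \<Longrightarrow> 0 \<le> w k" "(\<Sum>k\<in>I. w k) = 1"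
    and \<nu>: "\<And>k. k \<in> I \<Longrightarrow> real_distribution (\<nu> k)" "\<And>k. k \<in> I \<Longrightarrow> emeasure (\<nu> k) {..<0} = 0"
    and d: "\<And>k. k \<in> I \<Longrightarrow> 0 \<le> d k" "\<And>k. k \<in> I \<Longrightarrow> ennreal (d k) \<le> (\<integral>\<^sup>+x. ennreal x \<partial>\<nu> k)"
    and mix: "sets \<mu> = sets borel"
      "\<And>A. A \<in> sets borel \<Longrightarrow> emeasure \<mu> A = (\<Sum>k\<in>I. ennreal (w k) * emeasure (\<nu> k) A)"
    and mean: "sets \<mu>' = sets borel"
      "\<And>A. A \<in> sets borel \<Longrightarrow> emeasure \<mu>' A = (\<Sum>k\<in>I. ennreal (w k) * indicator A (d k))"
  shows "risk_of_law S \<rho> \<mu>' \<le> risk_of_law S \<rho> \<mu>"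
proof -
  obtain L and V :: "'s \<Rightarrow> real" where L[measurable]: "L \<in> measurable S (count_space I)" and V[measurable]: "V \<in> borel_measurable S"
    and V01: "\<And>\<omega>. 0 \<le> V \<omega> \<and> V \<omega> < 1"
    and LV: "\<And>k A. k \<in> I \<Longrightarrow> A \<in> sets borel \<Longrightarrow>
       emeasure S {\<omega> \<in> space S. L \<omega> = k \<and> V \<omega> \<in> A} = ennreal (w k) * emeasure lborel {v \<in> {0..<1}. v \<in> A}"
    by (rule labelled_uniform_variable[OF I w]) blast+
  have L_I: "L \<omega> \<in> I" if "\<omega> \<in> space S" for \<omega>
    using measurable_space[OF L that] by simp
  have meas: "(\<lambda>\<omega>. f (L \<omega>) (V \<omega>)) \<in> borel_measurable S" if "\<And>k. k \<in> I \<Longrightarrow> f k \<in> borel_measurable borel" for f :: "'i \<Rightarrow> real \<Rightarrow> real"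
    by (rule measurable_compose_countable'[OF measurable_compose[OF V that] L]) (use I in \<open>auto simp: countable_finite\<close>)
  have law: "emeasure (distr S borel (\<lambda>\<omega>. f (L \<omega>) (V \<omega>))) A
      = (\<Sum>k\<in>I. ennreal (w k) * emeasure lborel {v \<in> {0..<1}. f k v \<in> A})"
    if f: "\<And>k. k \<in> I \<Longrightarrow> f k \<in> borel_measurable borel" and A: "A \<in> sets borel" for f :: "'i \<Rightarrow> real \<Rightarrow> real" and A
  proof -
    have sets: "f k -` A \<in> sets borel" if "k \<in> I" for k
      using measurable_sets[OF f[OF that] A] by simp
    have "emeasure (distr S borel (\<lambda>\<omega>. f (L \<omega>) (V \<omega>))) A = emeasure S ((\<lambda>\<omega>. f (L \<omega>) (V \<omega>)) -` A \<inter> space S)"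
      by (rule emeasure_distr[OF meas[OF f] A])
    also have "(\<lambda>\<omega>. f (L \<omega>) (V \<omega>)) -` A \<inter> space S = (\<Union>k\<in>I. {\<omega> \<in> space S. L \<omega> = k \<and> V \<omega> \<in> f k -` A})"
      using L_I by auto
    also have "emeasure S \<dots> = (\<Sum>k\<in>I. emeasure S {\<omega> \<in> space S. L \<omega> = k \<and> V \<omega> \<in> f k -` A})"
    proof (rule sum_emeasure[symmetric])
      show "(\<lambda>k. {\<omega> \<in> space S. L \<omega> = k \<and> V \<omega> \<in> f k -` A}) ` I \<subseteq> sets S"
      proof safe
        fix k assume "k \<in> I"
        then have "L -` {k} \<inter> space S \<in> sets S" "V -` (f k -` A) \<inter> space S \<in> sets S"
          using measurable_sets[OF L, of "{k}"] measurable_sets[OF V sets[of k]] by auto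
        then have "(L -` {k} \<inter> space S) \<inter> (V -` (f k -` A) \<inter> space S) \<in> sets S"
          by (rule sets.Int)
        also have "(L -` {k} \<inter> space S) \<inter> (V -` (f k -` A) \<inter> space S) = {\<omega> \<in> space S. L \<omega> = k \<and> V \<omega> \<in> f k -` A}"
          by auto
        finally show "{\<omega> \<in> space S. L \<omega> = k \<and> V \<omega> \<in> f k -` A} \<in> sets S" .
      qed
    qed (use I in \<open>auto simp: disjoint_family_on_def\<close>)
    also have "\<dots> = (\<Sum>k\<in>I. ennreal (w k) * emeasure lborel {v \<in> {0..<1}. f k v \<in> A})"
      using LV[OF _ sets] by (intro sum.cong refl) simp
    finally show ?thesis .
  qed
  have "\<exists>h :: real \<Rightarrow> real. h \<in> borel_measurable borel \<and> mono_on {0..<1} h \<and> (\<forall>v. 0 \<le> h v) \<and>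
      (\<forall>A\<in>sets borel. emeasure lborel {v \<in> {0..<1}. h v \<in> A} = emeasure (\<nu> k) A)" if "k \<in> I" for k
    by (rule quantile_function[OF \<nu>[OF that]]) blast
  then have "\<exists>h :: 'i \<Rightarrow> real \<Rightarrow> real. \<forall>k\<in>I. h k \<in> borel_measurable borel \<and> mono_on {0..<1} (h k) \<and> (\<forall>v. 0 \<le> h k v) \<and>
      (\<forall>A\<in>sets borel. emeasure lborel {v \<in> {0..<1}. h k v \<in> A} = emeasure (\<nu> k) A)"
    by (intro bchoice ballI)
  then obtain h :: "'i \<Rightarrow> real \<Rightarrow> real" where h_meas: "\<And>k. k \<in> I \<Longrightarrow> h k \<in> borel_measurable borel"
    and h_mono: "\<And>k. k \<in> I \<Longrightarrow> mono_on {0..<1} (h k)" and h_nonneg: "\<And>k v. k \<in> I \<Longrightarrow> 0 \<le> h k v"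
    and h_law: "\<And>k A. k \<in> I \<Longrightarrow> A \<in> sets borel \<Longrightarrow> emeasure lborel {v \<in> {0..<1}. h k v \<in> A} = emeasure (\<nu> k) A"
    by blast
  have frac[measurable]: "frac \<in> borel_measurable (borel :: real measure)"
    unfolding frac_def[abs_def] by measurable
  define X where "X s \<omega> = h (L \<omega>) (frac (V \<omega> + s))" for s \<omega>
  have hs_meas: "(\<lambda>v. h k (frac (v + s))) \<in> borel_measurable borel" if "k \<in> I" for k s
    by (rule measurable_compose[OF _ h_meas[OF that]]) measurable
  have X: "X s \<in> nonneg_rv S" for s
    unfolding nonneg_rv_def X_def using meas[of "\<lambda>k v. h k (frac (v + s))", OF hs_meas] h_nonneg L_I by auto
  have "distr S borel (X s) = \<mu>" if s: "0 \<le> s" "s \<le> 1" for s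
  proof (rule measure_eqI)
    fix A assume "A \<in> sets (distr S borel (X s))"
    then have A: "A \<in> sets borel"
      by simp
    have "emeasure (distr S borel (X s)) A = (\<Sum>k\<in>I. ennreal (w k) * emeasure lborel {v \<in> {0..<1}. h k (frac (v + s)) \<in> A})"
      unfolding X_def by (rule law[OF hs_meas A])
    also have "\<dots> = (\<Sum>k\<in>I. ennreal (w k) * emeasure (\<nu> k) A)"
    proof (intro sum.cong refl arg_cong2[where f = "(*)"])
      fix k assume k: "k \<in> I"
      have "h k -` A \<in> sets borel"
        using measurable_sets[OF h_meas[OF k] A] by simp
      from emeasure_rotation_unit_interval[OF this s]
      show "emeasure lborel {v \<in> {0..<1}. h k (frac (v + s)) \<in> A} = emeasure (\<nu> k) A"
        by (simp add: h_law[OF k A, symmetric])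
    qed
    also have "\<dots> = emeasure \<mu> A"
      by (rule mix(2)[OF A, symmetric])
    finally show "emeasure (distr S borel (X s)) A = emeasure \<mu> A" .
  qed (simp add: mix(1))
  then have \<rho>_X: "\<rho> (X s) = risk_of_law S \<rho> \<mu>" if "0 \<le> s" "s \<le> 1" for s
    using risk_of_law_eq[OF X, of s] that by simp
  define D where "D \<omega> = d (L \<omega>)" for \<omega>
  have D: "D \<in> nonneg_rv S"
    unfolding nonneg_rv_def D_def using meas[of "\<lambda>k v. d k"] d(1) L_I by auto
  have "distr S borel D = \<mu>'"
  proof (rule measure_eqI)
    fix A assume "A \<in> sets (distr S borel D)"
    then have A: "A \<in> sets borel"
      by simp
    have "emeasure (distr S borel D) A = (\<Sum>k\<in>I. ennreal (w k) * emeasure lborel {v \<in> {0..<1 :: real}. d k \<in> A})"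
      unfolding D_def by (rule law[of "\<lambda>k v. d k", OF _ A]) simp
    also have "\<dots> = (\<Sum>k\<in>I. ennreal (w k) * indicator A (d k))"
    proof (intro sum.cong refl arg_cong2[where f = "(*)"])
      fix k
      have "{v \<in> {0..<1 :: real}. d k \<in> A} = (if d k \<in> A then {0..<1} else {})"
        by auto
      then show "emeasure lborel {v \<in> {0..<1 :: real}. d k \<in> A} = indicator A (d k)"
        by (simp only:) simp
    qed
    also have "\<dots> = emeasure \<mu>' A"
      by (rule mean(2)[OF A, symmetric])
    finally show "emeasure (distr S borel D) A = emeasure \<mu>' A" .
  qed (simp add: mean(1))
  then have \<rho>_D: "\<rho> D = risk_of_law S \<rho> \<mu>'"
    using risk_of_law_eq[OF D] by simp
  show ?thesis
  proof (rule ennreal_le_epsilon)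
    fix \<delta> :: real assume \<delta>: "0 < \<delta>"
    have "\<forall>\<^sub>F m in sequentially. d k \<le> 1 / real (Suc m) * (\<Sum>j<Suc m. h k (real j / real (Suc m))) + \<delta>" if k: "k \<in> I" for k
    proof (rule eventually_le_grid_average[OF h_mono[OF k] h_nonneg[OF k] h_meas[OF k] _ \<delta>])
      have "\<nu> k = distr (restrict_space lborel {0..<1}) borel (h k)"
      proof (rule measure_eqI)
        show sets: "sets (\<nu> k) = sets (distr (restrict_space lborel {0..<1}) borel (h k))"
          using \<nu>(1)[OF k] by (simp add: real_distribution.events_eq_borel)
        fix A assume "A \<in> sets (\<nu> k)"
        then have A: "A \<in> sets borel"
          unfolding sets by simp
        have "emeasure (distr (restrict_space lborel {0..<1}) borel (h k)) A
            = emeasure (restrict_space lborel {0..<1}) (h k -` A \<inter> {0..<1})"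
          using h_meas[OF k] A by (subst emeasure_distr) (auto simp: space_restrict_space intro: measurable_restrict_space1)
        also have "\<dots> = emeasure lborel (h k -` A \<inter> {0..<1})"
          by (rule emeasure_restrict_space) auto
        also have "h k -` A \<inter> {0..<1} = {v \<in> {0..<1}. h k v \<in> A}"
          by auto
        finally show "emeasure (\<nu> k) A = emeasure (distr (restrict_space lborel {0..<1}) borel (h k)) A"
          using h_law[OF k A] by (simp only:)
      qed
      then have "(\<integral>\<^sup>+x. ennreal x \<partial>\<nu> k) = (\<integral>\<^sup>+v. ennreal (h k v) \<partial>restrict_space lborel {0..<1})"
        using h_meas[OF k] by (simp add: nn_integral_distr measurable_restrict_space1)
      also have "\<dots> = (\<integral>\<^sup>+v. ennreal (h k v) * indicator {0..<1} v \<partial>lborel)"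
        by (rule nn_integral_restrict_space) simp
      finally show "ennreal (d k) \<le> (\<integral>\<^sup>+v. ennreal (h k v) * indicator {0..<1} v \<partial>lborel)"
        using d(2)[OF k] by simp
    qed
    \<comment> \<open>There are finitely many labels, so one grid serves all of them.\<close>
    then have "\<forall>\<^sub>F m in sequentially. \<forall>k\<in>I. d k \<le> 1 / real (Suc m) * (\<Sum>j<Suc m. h k (real j / real (Suc m))) + \<delta>"
      by (intro eventually_ball_finite[OF I] ballI)
    then have "\<exists>m. \<forall>k\<in>I. d k \<le> 1 / real (Suc m) * (\<Sum>j<Suc m. h k (real j / real (Suc m))) + \<delta>"
      by (rule eventually_happens'[OF sequentially_bot])
    then obtain m where m: "\<And>k. k \<in> I \<Longrightarrow> d k \<le> 1 / real (Suc m) * (\<Sum>j<Suc m. h k (real j / real (Suc m))) + \<delta>"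
      by blast
    let ?n = "Suc m"
    let ?s = "\<lambda>i. real i / real ?n"
    define Z where "Z \<omega> = (\<Sum>i<?n. X (?s i) \<omega>)" for \<omega>
    have Z: "Z \<in> nonneg_rv S"
      unfolding Z_def[abs_def] by (rule nonneg_rv_sum) (rule X)
    then have Zn: "(\<lambda>\<omega>. 1 / real ?n * Z \<omega>) \<in> nonneg_rv S"
      by (auto simp: nonneg_rv_def)
    then have Zd: "(\<lambda>\<omega>. 1 / real ?n * Z \<omega> + \<delta>) \<in> nonneg_rv S"
      using \<delta> by (auto simp: nonneg_rv_def)
    have "\<rho> D \<le> \<rho> (\<lambda>\<omega>. 1 / real ?n * Z \<omega> + \<delta>)"
    proof (rule monotonicity[OF Zd D])
      fix \<omega> assume \<omega>: "\<omega> \<in> space S"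
      have "d (L \<omega>) \<le> 1 / real ?n * (\<Sum>j<?n. h (L \<omega>) (real j / real ?n)) + \<delta>"
        using m[OF L_I[OF \<omega>]] .
      also have "\<dots> \<le> 1 / real ?n * Z \<omega> + \<delta>"
        unfolding Z_def X_def using V01[of \<omega>]
        by (intro add_right_mono mult_left_mono sum_grid_le_sum_rotations h_mono L_I \<omega>) auto
      finally show "D \<omega> \<le> 1 / real ?n * Z \<omega> + \<delta>"
        by (simp add: D_def)
    qed
    also have "\<dots> = ennreal (1 / real ?n) * \<rho> Z + ennreal \<delta>"
      using \<delta> by (subst translation[OF Zn]) (simp_all only: positive_homogeneity[OF Z] less_imp_le of_nat_0_less_iff zero_less_divide_1_iff zero_less_Suc)
    also have "\<rho> Z \<le> (\<Sum>i<?n. \<rho> (X (?s i)))"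
      unfolding Z_def by (rule risk_sum_le) (use X in auto)
    also have "(\<Sum>i<?n. \<rho> (X (?s i))) = (\<Sum>i<?n. risk_of_law S \<rho> \<mu>)"
      by (intro sum.cong refl \<rho>_X) auto
    also have "\<dots> = ennreal (real ?n) * risk_of_law S \<rho> \<mu>"
      by (simp only: sum_constant card_lessThan ennreal_of_nat_eq_real_of_nat)
    also have "ennreal (1 / real ?n) * (ennreal (real ?n) * risk_of_law S \<rho> \<mu>) = risk_of_law S \<rho> \<mu>"
      by (subst mult.assoc[symmetric], subst ennreal_mult[symmetric]) auto
    finally show "risk_of_law S \<rho> \<mu>' \<le> risk_of_law S \<rho> \<mu> + ennreal \<delta>"
      by (simp add: \<rho>_D mult_left_mono add_right_mono)
  qed
qed

end

section \<open>Conditioning and discrete couplings\<close>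

context law_invariant_coherent_risk
begin

lemma risk_of_law_point_mass:
  assumes "0 \<le> r"
  shows "risk_of_law S \<rho> (return borel r) = ennreal r"
proof -
  have "risk_of_law S \<rho> (distr S borel (\<lambda>_. r)) = \<rho> (\<lambda>_. r)"
    using assms by (intro risk_of_law_eq) (simp add: nonneg_rv_def)
  also have "\<rho> (\<lambda>_. r) = ennreal r"
    using translation[of "\<lambda>_. 0" r] assms by (simp add: nonneg_rv_def risk_zero)
  finally show ?thesis
    by simp
qed

text \<open>
  The mixture with a single component: a constant below the mean has at most the risk of the law.
\<close>

lemma expectation_le_risk_of_law:
  assumes "real_distribution \<nu>" "emeasure \<nu> {..<0} = 0"
  shows "(\<integral>\<^sup>+x. ennreal x \<partial>\<nu>) \<le> risk_of_law S \<rho> \<nu>"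
proof (rule dense_le)
  fix y assume y: "y < (\<integral>\<^sup>+x. ennreal x \<partial>\<nu>)"
  then obtain r where r: "0 \<le> r" "y = ennreal r"
    by (cases y) auto
  have sets: "sets \<nu> = sets borel"
    using assms(1) by (rule real_distribution.events_eq_borel)
  have "risk_of_law S \<rho> (return borel r) \<le> risk_of_law S \<rho> \<nu>"
    by (rule risk_of_law_mixture_of_means_le[where I = "{()}" and w = "\<lambda>_. 1" and \<nu> = "\<lambda>_. \<nu>" and d = "\<lambda>_. r"])
      (use assms r y sets in \<open>auto intro: less_imp_le\<close>)
  then show "y \<le> risk_of_law S \<rho> \<nu>"
    using risk_of_law_point_mass[OF r(1)] r(2) by simp
qed

end

text \<open>
  The sets \<open>A k\<close> may coincide for several \<open>k\<close>, with the weights \<open>c k\<close> sharing the mass among them; this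
  is how repeated atoms \<open>xh i = xh i'\<close> are treated.
\<close>

lemma (in prob_space) weighted_cover:
  assumes I: "finite I" and A: "\<And>k. k \<in> I \<Longrightarrow> A k \<in> events" and c: "\<And>k. k \<in> I \<Longrightarrow> 0 \<le> c k"
    and cover: "AE z in M. (\<Sum>k\<in>I. c k * indicator (A k) z) = (1 :: real)"
  shows emeasure_weighted_cover:
      "B \<in> events \<Longrightarrow> emeasure M B = (\<Sum>k\<in>I. ennreal (c k) * emeasure M (A k \<inter> B))"
    and integral_weighted_cover:
      "integrable M f \<Longrightarrow> (\<integral>z. f z \<partial>M) = (\<Sum>k\<in>I. c k * (\<integral>z. indicator (A k) z * f z \<partial>M))"
proof -
  assume B: "B \<in> events"
  have "emeasure M B = (\<integral>\<^sup>+z. indicator B z \<partial>M)"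
    using B by simp
  also have "\<dots> = (\<integral>\<^sup>+z. (\<Sum>k\<in>I. ennreal (c k) * indicator (A k \<inter> B) z) \<partial>M)"
  proof (rule nn_integral_cong_AE)
    show "AE z in M. indicator B z = (\<Sum>k\<in>I. ennreal (c k) * indicator (A k \<inter> B) z)"
      using cover
    proof eventually_elim
      case (elim z)
      have "(\<Sum>k\<in>I. ennreal (c k) * indicator (A k \<inter> B) z) = (\<Sum>k\<in>I. ennreal (c k * indicator (A k) z) * indicator B z)"
        by (intro sum.cong refl) (auto simp: indicator_def)
      also have "\<dots> = ennreal (\<Sum>k\<in>I. c k * indicator (A k) z) * indicator B z"
        using c by (subst sum_distrib_right[symmetric]) (simp add: sum_ennreal)
      finally show ?case
        by (simp add: elim)
    qed
  qed
  also have "\<dots> = (\<Sum>k\<in>I. ennreal (c k) * emeasure M (A k \<inter> B))"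
    using A B by (subst nn_integral_sum) (auto intro!: sum.cong nn_integral_cmult_indicator)
  finally show "emeasure M B = (\<Sum>k\<in>I. ennreal (c k) * emeasure M (A k \<inter> B))" .
next
  assume f: "integrable M f"
  have int: "integrable M (\<lambda>z. indicator (A k) z * f z)" if "k \<in> I" for k
    using integrable_mult_indicator[OF A[OF that] f] by simp
  have "(\<integral>z. f z \<partial>M) = (\<integral>z. (\<Sum>k\<in>I. c k * (indicator (A k) z * f z)) \<partial>M)"
  proof (rule integral_cong_AE)
    show "AE z in M. f z = (\<Sum>k\<in>I. c k * (indicator (A k) z * f z))"
      using cover
    proof eventually_elim
      case (elim z)
      have "(\<Sum>k\<in>I. c k * (indicator (A k) z * f z)) = (\<Sum>k\<in>I. c k * indicator (A k) z) * f z"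
        by (simp add: sum_distrib_right mult.assoc)
      then show ?case
        by (simp add: elim)
    qed
  qed (use int f in \<open>auto intro!: borel_measurable_sum borel_measurable_times dest: borel_measurable_integrable\<close>)
  also have "\<dots> = (\<Sum>k\<in>I. c k * (\<integral>z. indicator (A k) z * f z \<partial>M))"
    using int by (subst Bochner_Integration.integral_sum) auto
  finally show "(\<integral>z. f z \<partial>M) = (\<Sum>k\<in>I. c k * (\<integral>z. indicator (A k) z * f z \<partial>M))" .
qed

lemma (in prob_space) uniform_measure_integral:
  fixes f :: "'a \<Rightarrow> 'b::{banach, second_countable_topology}"
  assumes A: "A \<in> events" "0 < prob A" and f: "integrable M f"
  shows integrable_uniform_measure: "integrable (uniform_measure M A) f"
    and integral_uniform_measure:
      "integral\<^sup>L (uniform_measure M A) f = (1 / prob A) *\<^sub>R (\<integral>z. indicator A z *\<^sub>R f z \<partial>M)"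
proof -
  have eq: "uniform_measure M A = density M (\<lambda>z. ennreal (indicator A z / prob A))"
    unfolding uniform_measure_def using A divide_ennreal[of 1 "prob A"]
    by (intro density_cong) (auto simp: emeasure_eq_measure indicator_def divide_ennreal intro!: AE_I2)
  have meas: "f \<in> borel_measurable M" "(\<lambda>z. indicator A z / prob A) \<in> borel_measurable M"
    using A f by auto
  have int: "integrable M (\<lambda>z. (1 / prob A) *\<^sub>R (indicator A z *\<^sub>R f z))"
    using integrable_mult_indicator[OF A(1) f] by (rule integrable_scaleR_right[rotated])
  show "integrable (uniform_measure M A) f"
    unfolding eq using int A by (subst integrable_density[OF meas]) auto
  have "integral\<^sup>L (uniform_measure M A) f = (\<integral>z. (1 / prob A) *\<^sub>R (indicator A z *\<^sub>R f z) \<partial>M)"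
    unfolding eq using A by (subst integral_density[OF meas]) auto
  also have "\<dots> = (1 / prob A) *\<^sub>R (\<integral>z. indicator A z *\<^sub>R f z \<partial>M)"
    by (rule integral_scaleR_right)
  finally show "integral\<^sup>L (uniform_measure M A) f = (1 / prob A) *\<^sub>R (\<integral>z. indicator A z *\<^sub>R f z \<partial>M)" .
qed

lemma ext_expectation_integrable:
  assumes "integrable M f"
  shows "ext_expectation M f = ereal (integral\<^sup>L M f)"
proof -
  obtain r q where rq: "0 \<le> r" "0 \<le> q" "(\<integral>\<^sup>+x. ennreal (f x) \<partial>M) = ennreal r"
    "(\<integral>\<^sup>+x. ennreal (- f x) \<partial>M) = ennreal q" "integral\<^sup>L M f = r - q"
    using integrableE[OF assms] by metis
  then show ?thesis
    by (simp add: ext_expectation_def)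
qed

lemma sets_discrete_measure [simp]: "sets (discrete_measure M I w x) = sets M"
  and space_discrete_measure [simp]: "space (discrete_measure M I w x) = space M"
  by (simp_all add: discrete_measure_def)

lemma discrete_measure_integral:
  fixes f :: "'a \<Rightarrow> real"
  assumes "finite I" "\<And>k. k \<in> I \<Longrightarrow> 0 \<le> w k" "x ` I \<subseteq> space M" "f \<in> borel_measurable M"
  shows integrable_discrete_measure: "integrable (discrete_measure M I w x) f"
    and integral_discrete_measure: "(\<integral>z. f z \<partial>discrete_measure M I w x) = (\<Sum>k\<in>I. w k * f (x k))"
proof -
  have x: "x \<in> measurable (point_measure I (\<lambda>k. ennreal (w k))) M"
    using assms(3) by auto
  have "integrable (point_measure I (\<lambda>k. ennreal (w k))) (\<lambda>k. f (x k))"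
    by (rule integrable_point_measure_finite[OF assms(1)])
  then show "integrable (discrete_measure M I w x) f"
    unfolding discrete_measure_def by (subst integrable_distr_eq[OF x assms(4)])
  show "(\<integral>z. f z \<partial>discrete_measure M I w x) = (\<Sum>k\<in>I. w k * f (x k))"
    unfolding discrete_measure_def using assms(1,2)
    by (subst integral_distr[OF x assms(4)]) (simp add: lebesgue_integral_point_measure_finite)
qed

lemma measurable_trace_borel:
  fixes f :: "'a::topological_space \<Rightarrow> 'b"
  assumes "f \<in> measurable borel M"
  shows "f \<in> measurable (restrict_space borel \<Xi>) M"
  using assms by (rule measurable_restrict_space1)

lemma measurable_coupling_projections [measurable]:
  fixes \<Xi> :: "'a::topological_space set"
  shows "fst \<in> borel_measurable (restrict_space borel \<Xi> \<Otimes>\<^sub>M restrict_space borel \<Xi>)"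
    and "snd \<in> borel_measurable (restrict_space borel \<Xi> \<Otimes>\<^sub>M restrict_space borel \<Xi>)"
  using measurable_trace_borel[of "\<lambda>x. x" borel \<Xi>]
  by (auto intro: measurable_compose[OF measurable_fst] measurable_compose[OF measurable_snd])

lemma measurable_transport_cost:
  fixes nrm :: "'a::euclidean_space \<Rightarrow> real"
  assumes "is_norm nrm"
  shows "(\<lambda>(x, y). nrm (x - y)) \<in> borel_measurable (restrict_space borel \<Xi> \<Otimes>\<^sub>M restrict_space borel \<Xi>)"
  unfolding case_prod_beta
  by (rule measurable_compose[OF _ is_norm_measurable[OF assms]]) measurable

lemma sets_discrete_coupling [simp]:
  "sets (discrete_coupling \<Xi> N K xh p \<xi>) = sets (restrict_space borel \<Xi> \<Otimes>\<^sub>M restrict_space borel \<Xi>)"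
  by (simp add: discrete_coupling_def)

lemma space_discrete_coupling [simp]: "space (discrete_coupling \<Xi> N K xh p \<xi>) = \<Xi> \<times> \<Xi>"
  by (simp add: discrete_coupling_def space_pair_measure space_restrict_space)

lemma emeasure_discrete_coupling:
  assumes "\<And>i j. i \<in> {1..N} \<Longrightarrow> j \<in> {1..K} \<Longrightarrow> xh i \<in> \<Xi> \<and> \<xi> i j \<in> \<Xi>"
    and "B \<in> sets (restrict_space borel \<Xi> \<Otimes>\<^sub>M restrict_space borel \<Xi>)"
  shows "emeasure (discrete_coupling \<Xi> N K xh p \<xi>) B
    = (\<Sum>(i, j)\<in>{1..N} \<times> {1..K}. ennreal (p i j / real N) * indicator B (xh i, \<xi> i j))"
proof -
  have "emeasure (discrete_coupling \<Xi> N K xh p \<xi>) B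
      = (\<Sum>k\<in>{1..N} \<times> {1..K}. ennreal ((\<lambda>(i, j). p i j / real N) k) * indicator B ((\<lambda>(i, j). (xh i, \<xi> i j)) k))"
    unfolding discrete_coupling_def
  proof (rule emeasure_discrete_measure)
    show "(\<lambda>(i, j). (xh i, \<xi> i j)) ` ({1..N} \<times> {1..K}) \<subseteq> space (restrict_space borel \<Xi> \<Otimes>\<^sub>M restrict_space borel \<Xi>)"
      using assms(1) by (auto simp: space_pair_measure space_restrict_space)
  qed (use assms(2) in auto)
  then show ?thesis
    by (simp add: case_prod_beta)
qed

lemma discrete_coupling_feasible:
  fixes \<Xi> :: "'a::euclidean_space set"
  assumes N: "1 \<le> N" and xh: "\<And>i. i \<in> {1..N} \<Longrightarrow> xh i \<in> \<Xi>"
    and p: "\<And>i j. i \<in> {1..N} \<Longrightarrow> j \<in> {1..K} \<Longrightarrow> 0 \<le> p i j \<and> \<xi> i j \<in> \<Xi>"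
    and sum_p: "\<And>i. i \<in> {1..N} \<Longrightarrow> (\<Sum>j=1..K. p i j) = 1"
  shows "discrete_coupling \<Xi> N K xh p \<xi> \<in> couplings \<Xi> N xh"
proof -
  let ?R = "restrict_space borel \<Xi>"
  let ?D = "discrete_coupling \<Xi> N K xh p \<xi>"
  have mem: "xh i \<in> \<Xi> \<and> \<xi> i j \<in> \<Xi>" if "i \<in> {1..N}" "j \<in> {1..K}" for i j
    using xh p that by blast
  have fst: "fst \<in> measurable ?D ?R"
    by (subst measurable_cong_sets[OF sets_discrete_coupling refl]) simp
  have marg: "distr ?D ?R fst = empirical_measure \<Xi> N xh"
  proof (rule measure_eqI)
    show "sets (distr ?D ?R fst) = sets (empirical_measure \<Xi> N xh)"
      by (simp add: empirical_measure_def)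
    fix B assume "B \<in> sets (distr ?D ?R fst)"
    then have B: "B \<in> sets ?R"
      by simp
    have "emeasure (distr ?D ?R fst) B = emeasure ?D (fst -` B \<inter> space ?D)"
      using fst B by (rule emeasure_distr)
    also have "\<dots> = (\<Sum>(i, j)\<in>{1..N} \<times> {1..K}. ennreal (p i j / real N) * indicator (fst -` B \<inter> space ?D) (xh i, \<xi> i j))"
      using measurable_sets[OF fst B] unfolding sets_discrete_coupling by (intro emeasure_discrete_coupling[OF mem])
    also have "\<dots> = (\<Sum>i=1..N. \<Sum>j=1..K. ennreal (p i j / real N) * indicator B (xh i))"
      unfolding sum.cartesian_product using mem by (intro sum.cong refl) (auto simp: indicator_def)
    also have "\<dots> = (\<Sum>i=1..N. ennreal (1 / real N) * indicator B (xh i))"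
    proof (intro sum.cong refl)
      fix i assume i: "i \<in> {1..N}"
      have "(\<Sum>j=1..K. ennreal (p i j / real N)) = ennreal (\<Sum>j=1..K. p i j / real N)"
        using p i by (intro sum_ennreal) auto
      also have "(\<Sum>j=1..K. p i j / real N) = 1 / real N"
        unfolding sum_divide_distrib[symmetric] sum_p[OF i] ..
      finally show "(\<Sum>j=1..K. ennreal (p i j / real N) * indicator B (xh i)) = ennreal (1 / real N) * indicator B (xh i)"
        by (simp only: sum_distrib_right[symmetric])
    qed
    also have "\<dots> = emeasure (empirical_measure \<Xi> N xh) B"
      unfolding empirical_measure_def
      by (rule emeasure_discrete_measure[symmetric]) (use xh B in \<open>auto simp: space_restrict_space\<close>)
    finally show "emeasure (distr ?D ?R fst) B = emeasure (empirical_measure \<Xi> N xh) B" .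
  qed
  have "emeasure ?D (space ?D) = emeasure (distr ?D ?R fst) \<Xi>"
    by (subst emeasure_distr[OF fst])
      (auto simp: sets_restrict_space space_restrict_space intro!: image_eqI[of _ _ UNIV] arg_cong[where f = "emeasure ?D"])
  also have "\<dots> = (\<Sum>i=1..N. ennreal (1 / real N) * indicator \<Xi> (xh i))"
    unfolding marg empirical_measure_def
    by (rule emeasure_discrete_measure) (use xh in \<open>auto simp: space_restrict_space sets_restrict_space intro!: image_eqI[of _ _ UNIV]\<close>)
  also have "\<dots> = (\<Sum>i=1..N. ennreal (1 / real N))"
    using xh by (intro sum.cong refl) simp
  also have "\<dots> = ennreal (\<Sum>i=1..N. 1 / real N)"
    by (rule sum_ennreal) simp
  also have "\<dots> = 1"
    using N by simp
  finally have "prob_space ?D"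
    by (rule prob_spaceI)
  with marg show ?thesis
    by (simp add: couplings_def)
qed

lemma ext_expectation_discrete_coupling:
  fixes \<Xi> :: "'a::euclidean_space set" and f :: "'a \<Rightarrow> real"
  assumes xh: "\<And>i. i \<in> {1..N} \<Longrightarrow> xh i \<in> \<Xi>"
    and p: "\<And>i j. i \<in> {1..N} \<Longrightarrow> j \<in> {1..K} \<Longrightarrow> 0 \<le> p i j \<and> \<xi> i j \<in> \<Xi>"
    and f: "f \<in> borel_measurable borel"
  shows "ext_expectation (discrete_coupling \<Xi> N K xh p \<xi>) (\<lambda>(x, y). f y)
    = ereal (1 / real N * (\<Sum>i=1..N. \<Sum>j=1..K. p i j * f (\<xi> i j)))"
proof -
  let ?P = "restrict_space borel \<Xi> \<Otimes>\<^sub>M restrict_space borel \<Xi>"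
  let ?I = "{1..N} \<times> {1..K}"
  let ?w = "\<lambda>(i, j). p i j / real N"
  let ?x = "\<lambda>(i, j). (xh i, \<xi> i j)"
  have I: "finite ?I" "\<And>k. k \<in> ?I \<Longrightarrow> 0 \<le> ?w k" "?x ` ?I \<subseteq> space ?P"
    using xh p by (auto simp: space_pair_measure space_restrict_space)
  have meas: "(\<lambda>(x, y). f y) \<in> borel_measurable ?P"
    unfolding case_prod_beta by (rule measurable_compose[OF measurable_coupling_projections(2) f])
  have "ext_expectation (discrete_coupling \<Xi> N K xh p \<xi>) (\<lambda>(x, y). f y)
      = ereal (\<Sum>k\<in>?I. ?w k * (\<lambda>(x, y). f y) (?x k))"
    unfolding discrete_coupling_def
    using integral_discrete_measure[OF I meas] ext_expectation_integrable[OF integrable_discrete_measure[OF I meas]]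
    by simp
  also have "(\<Sum>k\<in>?I. ?w k * (\<lambda>(x, y). f y) (?x k)) = (\<Sum>i=1..N. \<Sum>j=1..K. p i j / real N * f (\<xi> i j))"
    unfolding sum.cartesian_product by (simp add: case_prod_beta)
  also have "\<dots> = 1 / real N * (\<Sum>i=1..N. \<Sum>j=1..K. p i j * f (\<xi> i j))"
    by (simp add: sum_distrib_left)
  finally show ?thesis .
qed

section \<open>Discretizing a coupling\<close>

text \<open>
  The selector \<open>J\<close> names the piece that is active at a point.  The part \<open>A (i, j)\<close> consists of the pairs
  \<open>(xh i, y)\<close> with \<open>J y = j\<close>.  The same atom may be listed \<open>m\<close> times, and then each of its indices gets the
  fraction \<open>1 / m\<close> of the mass, so that \<open>p i j = N * c (i, j) * Q (A (i, j))\<close> sums to \<open>1\<close> over \<open>j\<close>.  The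
  last conclusion says that expectations of functions that are affine on the parts are preserved.
\<close>

lemma (in law_invariant_coherent_risk) coupling_discretization:
  fixes \<Xi> :: "'a::euclidean_space set" and J :: "'a \<Rightarrow> nat"
  assumes "convex \<Xi>" and N: "1 \<le> N" and xh: "\<And>i. i \<in> {1..N} \<Longrightarrow> xh i \<in> \<Xi>" and nrm: "is_norm nrm"
    and Q: "Q \<in> couplings \<Xi> N xh" and risk: "transport_risk S \<rho> nrm Q < \<infinity>"
    and J[measurable]: "J \<in> measurable borel (count_space UNIV)" and J_le: "\<And>y. J y \<in> {1..K}"
  obtains p \<xi> where "\<And>i j. i \<in> {1..N} \<Longrightarrow> j \<in> {1..K} \<Longrightarrow> 0 \<le> p i j \<and> \<xi> i j \<in> \<Xi>"
    "\<And>i. i \<in> {1..N} \<Longrightarrow> (\<Sum>j=1..K. p i j) = 1"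
    "transport_risk S \<rho> nrm (discrete_coupling \<Xi> N K xh p \<xi>) \<le> transport_risk S \<rho> nrm Q"
    "\<And>f. (\<And>j. j \<in> {1..K} \<Longrightarrow> is_affine (f j)) \<Longrightarrow>
       (\<lambda>y. f (J y) y) \<in> borel_measurable borel \<Longrightarrow>
       integrable Q (\<lambda>z. f (J (snd z)) (snd z)) \<and>
       (\<integral>z. f (J (snd z)) (snd z) \<partial>Q) = 1 / real N * (\<Sum>i=1..N. \<Sum>j=1..K. p i j * f j (\<xi> i j))"
proof -
  let ?R = "restrict_space borel \<Xi>"
  let ?P = "?R \<Otimes>\<^sub>M ?R"
  define \<phi> where "\<phi> = (\<lambda>(x, y). nrm (x - y))"
  interpret Q: prob_space Q
    using Q by (simp add: couplings_def)
  have sets_Q: "sets Q = sets ?P" and marg: "distr Q ?R fst = empirical_measure \<Xi> N xh"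
    using Q by (auto simp: couplings_def)
  have space_Q: "space Q = \<Xi> \<times> \<Xi>"
    using sets_eq_imp_space_eq[OF sets_Q] by (simp add: space_pair_measure space_restrict_space)
  have fst[measurable]: "fst \<in> borel_measurable Q" and snd[measurable]: "snd \<in> borel_measurable Q"
    and fst_R: "fst \<in> measurable Q ?R" and \<phi>[measurable]: "\<phi> \<in> borel_measurable Q"
    unfolding \<phi>_def measurable_cong_sets[OF sets_Q refl]
    using measurable_transport_cost[OF nrm] by auto
  have \<phi>_nonneg: "0 \<le> \<phi> z" for z
    by (simp add: \<phi>_def case_prod_beta is_norm_nonneg[OF nrm])
  have marg_eq: "Q.prob {z \<in> space Q. fst z \<in> B} = (\<Sum>l=1..N. indicator B (xh l)) / real N"
    if B: "B \<in> sets ?R" for B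
  proof -
    have "ennreal (Q.prob {z \<in> space Q. fst z \<in> B}) = emeasure Q (fst -` B \<inter> space Q)"
      by (simp add: Q.emeasure_eq_measure vimage_def Int_def conj_commute)
    also have "\<dots> = emeasure (distr Q ?R fst) B"
      using fst_R B by (rule emeasure_distr[symmetric])
    also have "\<dots> = (\<Sum>l=1..N. ennreal (1 / real N) * indicator B (xh l))"
      unfolding marg empirical_measure_def
      by (rule emeasure_discrete_measure) (use xh B in \<open>auto simp: space_restrict_space\<close>)
    also have "\<dots> = (\<Sum>l=1..N. ennreal (indicator B (xh l) / real N))"
      by (intro sum.cong refl) (auto simp: indicator_def)
    also have "\<dots> = ennreal (\<Sum>l=1..N. indicator B (xh l) / real N)"
      by (rule sum_ennreal) simp
    finally show ?thesis
      by (subst (asm) ennreal_inj) (auto simp: sum_divide_distrib intro!: sum_nonneg)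
  qed
  have finite_R: "B \<in> sets ?R" if "B \<subseteq> xh ` {1..N}" for B
  proof -
    have "finite B"
      using that by (rule finite_subset) simp
    moreover have "B = B \<inter> \<Xi>"
      using that xh by auto
    ultimately show ?thesis
      unfolding sets_restrict_space by (metis finite_imp_closed borel_closed image_eqI inf_commute)
  qed
  have fst_AE: "AE z in Q. fst z \<in> xh ` {1..N}"
  proof -
    have "Q.prob {z \<in> space Q. fst z \<in> xh ` {1..N}} = 1"
      using N by (subst marg_eq[OF finite_R]) auto
    moreover have "{z \<in> space Q. fst z \<in> xh ` {1..N}} \<in> sets Q"
      using measurable_sets[OF fst_R finite_R[OF order_refl]] by (simp add: vimage_def Int_def conj_commute)
    ultimately show ?thesis
      by (simp only: Q.prob_Collect_eq_1)
  qed

  define m where "m x = card {l \<in> {1..N}. xh l = x}" for x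
  have m_pos: "0 < m (xh i)" if "i \<in> {1..N}" for i
    using that by (auto simp: m_def card_gt_0_iff)
  define I where "I = {1..N} \<times> {1..K}"
  define A where "A = (\<lambda>(i, j). {z \<in> space Q. fst z = xh i \<and> J (snd z) = j})"
  define c where "c = (\<lambda>(i, j :: nat). 1 / real (m (xh i)))"
  have I: "finite I"
    by (simp add: I_def)
  have A: "A k \<in> sets Q" for k
    unfolding A_def case_prod_beta by measurable
  have c: "0 \<le> c k" for k
    by (simp add: c_def case_prod_beta)
  have cover: "AE z in Q. (\<Sum>k\<in>I. c k * indicator (A k) z) = (1 :: real)"
    using fst_AE AE_space
  proof eventually_elim
    case (elim z)
    have "(\<Sum>k\<in>I. c k * indicator (A k) z) = (\<Sum>i=1..N. \<Sum>j=1..K. if j = J (snd z) then (if xh i = fst z then 1 / real (m (fst z)) else 0) else 0)"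
      unfolding I_def sum.cartesian_product
      using elim by (intro sum.cong refl) (auto simp: A_def c_def indicator_def split: if_splits)
    also have "\<dots> = (\<Sum>i=1..N. if xh i = fst z then 1 / real (m (fst z)) else 0)"
      using J_le[of "snd z"] by (intro sum.cong refl) (simp add: sum.delta)
    also have "\<dots> = (\<Sum>i\<in>{l \<in> {1..N}. xh l = fst z}. 1 / real (m (fst z)))"
      by (rule sum.inter_filter[symmetric]) simp
    also have "\<dots> = 1"
    proof -
      have "0 < m (fst z)"
        using elim m_pos by auto
      then show ?thesis
        by (simp only: sum_constant m_def[symmetric]) simp
    qed
    finally show ?case .
  qed
  define w where "w k = c k * Q.prob (A k)" for k
  \<comment> \<open>On a part of mass zero, \<open>xh i\<close> is a point of \<open>\<Xi>\<close> with transport cost \<open>0\<close>.\<close>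
  define \<xi> where "\<xi> i j = (if 0 < Q.prob (A (i, j)) then \<integral>z. snd z \<partial>uniform_measure Q (A (i, j)) else xh i)" for i j
  define p where "p i j = real N * w (i, j)" for i j
  have w: "0 \<le> w k" for k
    by (simp add: w_def c)
  have sum_A: "(\<Sum>j=1..K. Q.prob (A (i, j))) = real (m (xh i)) / real N" if i: "i \<in> {1..N}" for i
  proof -
    have "(\<Sum>j=1..K. Q.prob (A (i, j))) = Q.prob (\<Union>j\<in>{1..K}. A (i, j))"
      using A by (intro Q.finite_measure_finite_Union[symmetric]) (auto simp: A_def disjoint_family_on_def)
    also have "(\<Union>j\<in>{1..K}. A (i, j)) = {z \<in> space Q. fst z \<in> {xh i}}"
      using J_le by (auto simp: A_def)
    also have "Q.prob \<dots> = (\<Sum>l=1..N. indicator {xh i} (xh l)) / real N"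
      using i by (intro marg_eq finite_R) auto
    also have "(\<Sum>l=1..N. indicator {xh i} (xh l)) = (\<Sum>l\<in>{l \<in> {1..N}. xh l = xh i}. 1 :: real)"
      by (subst sum.inter_filter, simp, rule sum.cong[OF refl], simp add: indicator_def)
    also have "\<dots> = real (m (xh i))"
      by (simp only: sum_constant m_def mult_1_right)
    finally show ?thesis .
  qed
  have sum_p: "(\<Sum>j=1..K. p i j) = 1" if i: "i \<in> {1..N}" for i
  proof -
    have "(\<Sum>j=1..K. p i j) = real N * (1 / real (m (xh i)) * (\<Sum>j=1..K. Q.prob (A (i, j))))"
      by (simp add: p_def w_def c_def sum_distrib_left)
    also have "\<dots> = 1"
      unfolding sum_A[OF i] using m_pos[OF i] N by simp
    finally show ?thesis .
  qed
  have w_eq: "w k = p (fst k) (snd k) / real N" for k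
    using N by (simp add: p_def)
  have sum_w: "(\<Sum>k\<in>I. w k) = 1"
  proof -
    have "(\<Sum>k\<in>I. w k) = (\<Sum>i=1..N. (\<Sum>j=1..K. p i j) / real N)"
      unfolding I_def by (simp add: w_eq sum_divide_distrib sum.cartesian_product case_prod_beta)
    also have "\<dots> = 1"
      using N sum_p by simp
    finally show ?thesis .
  qed

  define \<nu> where "\<nu> = distr Q borel \<phi>"
  have transport: "transport_risk S \<rho> nrm Q = risk_of_law S \<rho> \<nu>"
    by (simp add: transport_risk_def \<nu>_def \<phi>_def)
  have \<nu>: "real_distribution \<nu>" "emeasure \<nu> {..<0} = 0"
  proof -
    show "real_distribution \<nu>"
      unfolding \<nu>_def by (rule Q.real_distribution_distr) simp
    have "\<phi> -` {..<0} \<inter> space Q = {}"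
      using \<phi>_nonneg by (auto simp: not_less[symmetric])
    then show "emeasure \<nu> {..<0} = 0"
      unfolding \<nu>_def by (subst emeasure_distr) auto
  qed
  have "(\<integral>\<^sup>+z. ennreal (\<phi> z) \<partial>Q) = (\<integral>\<^sup>+x. ennreal x \<partial>\<nu>)"
    unfolding \<nu>_def by (subst nn_integral_distr) auto
  also have "\<dots> \<le> transport_risk S \<rho> nrm Q"
    unfolding transport by (rule expectation_le_risk_of_law[OF \<nu>])
  finally have int_\<phi>: "integrable Q \<phi>"
    using risk \<phi>_nonneg by (intro integrableI_nonneg) auto
  obtain b where b: "0 < b" "\<And>x. norm x \<le> b * nrm x"
    using is_norm_bounds_norm[OF nrm] by auto
  \<comment> \<open>The first coordinate is almost surely one of finitely many atoms, and the cost controls the Euclidean distance of the two coordinates.\<close>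
  have int_snd: "integrable Q snd"
  proof (rule Bochner_Integration.integrable_bound)
    show "integrable Q (\<lambda>z. Max ((\<lambda>i. norm (xh i)) ` {1..N}) + b * \<phi> z)"
      using int_\<phi> by simp
    show "AE z in Q. norm (snd z) \<le> norm (Max ((\<lambda>i. norm (xh i)) ` {1..N}) + b * \<phi> z)"
      using fst_AE
    proof eventually_elim
      case (elim z)
      have "norm (snd z) \<le> norm (fst z) + norm (fst z - snd z)"
        by (metis norm_minus_commute norm_triangle_sub)
      also have "norm (fst z) \<le> Max ((\<lambda>i. norm (xh i)) ` {1..N})"
        using elim by (intro Max_ge) auto
      also have "norm (fst z - snd z) \<le> b * \<phi> z"
        using b by (simp add: \<phi>_def case_prod_beta)
      finally show ?case
        by simp
    qed
  qed simp

  have cond_prob: "prob_space (uniform_measure Q (A k))" if "0 < Q.prob (A k)" for k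
    using that by (intro prob_space_uniform_measure) (auto simp: Q.emeasure_eq_measure)
  have cond_AE: "AE z in uniform_measure Q (A k). P z" if "\<And>z. z \<in> A k \<Longrightarrow> P z" for k P
    using A that by (intro AE_uniform_measureI) auto
  have \<xi>_mem: "\<xi> i j \<in> \<Xi>" if i: "i \<in> {1..N}" for i j
  proof (cases "0 < Q.prob (A (i, j))")
    case True
    have "(\<integral>z. snd z \<partial>uniform_measure Q (A (i, j))) \<in> \<Xi>"
      by (rule convex_integral_mem[OF cond_prob[OF True] Q.integrable_uniform_measure[OF A True int_snd] \<open>convex \<Xi>\<close>])
        (rule cond_AE, auto simp: A_def space_Q)
    with True show ?thesis
      by (simp add: \<xi>_def)
  qed (use xh[OF i] in \<open>simp add: \<xi>_def\<close>)

  define \<nu>' where "\<nu>' k = (if 0 < Q.prob (A k) then distr (uniform_measure Q (A k)) borel \<phi> else return borel 0)" for k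
  have meas_cond: "measurable (uniform_measure Q (A k)) M = measurable Q M" for k and M :: "real measure"
    by (rule measurable_cong_sets) auto
  have transport_le: "transport_risk S \<rho> nrm (discrete_coupling \<Xi> N K xh p \<xi>) \<le> transport_risk S \<rho> nrm Q"
    unfolding transport unfolding transport_risk_def
  proof (rule risk_of_law_mixture_of_means_le[OF I, where w = w and \<nu> = \<nu>' and d = "\<lambda>(i, j). nrm (xh i - \<xi> i j)"])
    show "(\<Sum>k\<in>I. w k) = 1"
      by (rule sum_w)
  next
    fix k assume "k \<in> I"
    show "0 \<le> w k"
      by (rule w)
    show "real_distribution (\<nu>' k)"
      using cond_prob[of k] prob_space.real_distribution_distr[of "uniform_measure Q (A k)" \<phi>] \<phi>
      by (auto simp: \<nu>'_def meas_cond real_distribution_def real_distribution_axioms_def prob_space_return)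
    have "\<phi> -` {..<0} \<inter> space Q = {}"
      using \<phi>_nonneg by (auto simp: not_less[symmetric])
    then show "emeasure (\<nu>' k) {..<0} = 0"
      using \<phi> by (auto simp: \<nu>'_def meas_cond emeasure_distr)
  next
    fix k assume k: "k \<in> I"
    obtain i j where ij: "k = (i, j)" "i \<in> {1..N}" "j \<in> {1..K}"
      using k by (auto simp: I_def)
    show "0 \<le> (case k of (i, j) \<Rightarrow> nrm (xh i - \<xi> i j))"
      by (simp add: ij is_norm_nonneg[OF nrm])
    show "ennreal (case k of (i, j) \<Rightarrow> nrm (xh i - \<xi> i j)) \<le> (\<integral>\<^sup>+x. ennreal x \<partial>\<nu>' k)"
    proof (cases "0 < Q.prob (A k)")
      case True
      let ?Q = "uniform_measure Q (A k)"
      interpret U: prob_space ?Q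
        by (rule cond_prob[OF True])
      have int: "integrable ?Q snd" "integrable ?Q \<phi>"
        by (intro Q.integrable_uniform_measure A True int_snd int_\<phi>)+
      have \<phi>_eq: "AE z in ?Q. nrm (xh i - snd z) = \<phi> z"
        by (rule cond_AE) (auto simp: A_def ij \<phi>_def case_prod_beta)
      have int': "integrable ?Q (\<lambda>z. nrm (xh i - snd z))"
      proof (subst integrable_cong_AE[OF _ _ \<phi>_eq])
        show "(\<lambda>z. nrm (xh i - snd z)) \<in> borel_measurable ?Q"
          unfolding meas_cond by (rule measurable_compose[OF _ is_norm_measurable[OF nrm]]) measurable
      qed (use int in auto)
      have "(\<integral>z. xh i - snd z \<partial>?Q) = xh i - (\<integral>z. snd z \<partial>?Q)"
        using int by (subst Bochner_Integration.integral_diff) (auto simp: U.prob_space[unfolded space_uniform_measure])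
      also have "(\<integral>z. snd z \<partial>?Q) = \<xi> i j"
        using True by (simp add: \<xi>_def ij)
      finally have "nrm (xh i - \<xi> i j) = nrm (\<integral>z. xh i - snd z \<partial>?Q)"
        by simp
      also have "\<dots> \<le> (\<integral>z. nrm (xh i - snd z) \<partial>?Q)"
        using int int' by (intro is_norm_integral_le[OF nrm cond_prob[OF True]]) auto
      also have "\<dots> = (\<integral>z. \<phi> z \<partial>?Q)"
        using int int' \<phi>_eq by (intro integral_cong_AE) auto
      finally have "ennreal (nrm (xh i - \<xi> i j)) \<le> ennreal (\<integral>z. \<phi> z \<partial>?Q)"
        by (rule ennreal_leI)
      also have "\<dots> = (\<integral>\<^sup>+z. ennreal (\<phi> z) \<partial>?Q)"
        using int \<phi>_nonneg by (intro nn_integral_eq_integral[symmetric]) auto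
      also have "\<dots> = (\<integral>\<^sup>+x. ennreal x \<partial>\<nu>' k)"
        using True \<phi> by (simp add: \<nu>'_def nn_integral_distr meas_cond)
      finally show ?thesis
        by (simp add: ij)
    next
      case False
      then show ?thesis
        using ij is_norm_eq_0_iff[OF nrm, of 0] by (simp add: \<xi>_def)
    qed
  next
    show "sets \<nu> = sets borel"
      by (simp add: \<nu>_def)
    fix B :: "real set" assume B: "B \<in> sets borel"
    have \<phi>B: "\<phi> -` B \<inter> space Q \<in> sets Q"
      using \<phi> B by (rule measurable_sets)
    have "emeasure \<nu> B = emeasure Q (\<phi> -` B \<inter> space Q)"
      unfolding \<nu>_def using \<phi> B by (rule emeasure_distr)
    also have "\<dots> = (\<Sum>k\<in>I. ennreal (c k) * emeasure Q (A k \<inter> (\<phi> -` B \<inter> space Q)))"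
      by (rule Q.emeasure_weighted_cover[OF I A c cover \<phi>B])
    also have "\<dots> = (\<Sum>k\<in>I. ennreal (w k) * emeasure (\<nu>' k) B)"
    proof (intro sum.cong refl)
      fix k
      show "ennreal (c k) * emeasure Q (A k \<inter> (\<phi> -` B \<inter> space Q)) = ennreal (w k) * emeasure (\<nu>' k) B"
      proof (cases "0 < Q.prob (A k)")
        case True
        have "emeasure (\<nu>' k) B = emeasure (uniform_measure Q (A k)) (\<phi> -` B \<inter> space Q)"
          using True \<phi> B by (simp add: \<nu>'_def emeasure_distr meas_cond)
        also have "\<dots> = ennreal (Q.prob (A k \<inter> (\<phi> -` B \<inter> space Q)) / Q.prob (A k))"
          using True A \<phi>B by (simp add: Q.emeasure_eq_measure divide_ennreal)
        finally show ?thesis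
          using True c[of k] by (simp add: w_def Q.emeasure_eq_measure ennreal_mult[symmetric])
      next
        case False
        then have zero: "Q.prob (A k) = 0"
          by (simp add: zero_less_measure_iff)
        have "Q.prob (A k \<inter> (\<phi> -` B \<inter> space Q)) \<le> Q.prob (A k)"
          using A by (intro Q.finite_measure_mono) auto
        with zero show ?thesis
          by (simp add: w_def Q.emeasure_eq_measure measure_le_0_iff)
      qed
    qed
    finally show "emeasure \<nu> B = (\<Sum>k\<in>I. ennreal (w k) * emeasure (\<nu>' k) B)" .
  next
    fix B :: "real set" assume B: "B \<in> sets borel"
    let ?D = "discrete_coupling \<Xi> N K xh p \<xi>"
    have cost: "(\<lambda>(x, y). nrm (x - y)) \<in> measurable ?D borel"
      using measurable_transport_cost[OF nrm] by (subst measurable_cong_sets[OF sets_discrete_coupling refl])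
    have mem: "xh i \<in> \<Xi> \<and> \<xi> i j \<in> \<Xi>" if "i \<in> {1..N}" "j \<in> {1..K}" for i j
      using xh \<xi>_mem that by blast
    have "emeasure (distr ?D borel (\<lambda>(x, y). nrm (x - y))) B = emeasure ?D ((\<lambda>(x, y). nrm (x - y)) -` B \<inter> space ?D)"
      using cost B by (rule emeasure_distr)
    also have "\<dots> = (\<Sum>(i, j)\<in>I. ennreal (p i j / real N) *
        indicator ((\<lambda>(x, y). nrm (x - y)) -` B \<inter> space ?D) (xh i, \<xi> i j))"
      using measurable_sets[OF cost B] unfolding sets_discrete_coupling I_def
      by (intro emeasure_discrete_coupling[OF mem])
    also have "\<dots> = (\<Sum>k\<in>I. ennreal (w k) * indicator B (case k of (i, j) \<Rightarrow> nrm (xh i - \<xi> i j)))"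
      using mem by (intro sum.cong refl) (auto simp: w_eq I_def indicator_def)
    finally show "emeasure (distr ?D borel (\<lambda>(x, y). nrm (x - y))) B = \<dots>" .
  qed simp

  have affine: "integrable Q (\<lambda>z. f (J (snd z)) (snd z)) \<and>
       (\<integral>z. f (J (snd z)) (snd z) \<partial>Q) = 1 / real N * (\<Sum>i=1..N. \<Sum>j=1..K. p i j * f j (\<xi> i j))"
    if aff: "\<And>j. j \<in> {1..K} \<Longrightarrow> is_affine (f j)" and f[measurable]: "(\<lambda>y. f (J y) y) \<in> borel_measurable borel" for f
  proof
    have "\<exists>h r. bounded_linear h \<and> f j = (\<lambda>x. h x + r)" if "j \<in> {1..K}" for j
      using aff[OF that] by (auto simp: is_affine_def linear_conv_bounded_linear)
    then obtain h r where hr: "\<And>j. j \<in> {1..K} \<Longrightarrow> bounded_linear (h j)" "\<And>j. j \<in> {1..K} \<Longrightarrow> f j = (\<lambda>x. h j x + r j)"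
      by metis
    have int_f: "integrable Q (\<lambda>z. f j (snd z))" if j: "j \<in> {1..K}" for j
      unfolding hr(2)[OF j] using integrable_bounded_linear[OF hr(1)[OF j] int_snd] by simp
    show int: "integrable Q (\<lambda>z. f (J (snd z)) (snd z))"
    proof (rule Bochner_Integration.integrable_bound)
      show "integrable Q (\<lambda>z. \<Sum>j=1..K. \<bar>f j (snd z)\<bar>)"
        using int_f by (intro Bochner_Integration.integrable_sum integrable_abs)
      show "(\<lambda>z. f (J (snd z)) (snd z)) \<in> borel_measurable Q"
        by (rule measurable_compose[OF snd f])
      show "AE z in Q. norm (f (J (snd z)) (snd z)) \<le> norm (\<Sum>j=1..K. \<bar>f j (snd z)\<bar>)"
      proof (rule AE_I2)
        fix z
        have "\<bar>f (J (snd z)) (snd z)\<bar> \<le> (\<Sum>j=1..K. \<bar>f j (snd z)\<bar>)"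
          using J_le by (intro member_le_sum) auto
        then show "norm (f (J (snd z)) (snd z)) \<le> norm (\<Sum>j=1..K. \<bar>f j (snd z)\<bar>)"
          by simp
      qed
    qed
    have "(\<integral>z. f (J (snd z)) (snd z) \<partial>Q) = (\<Sum>k\<in>I. c k * (\<integral>z. indicator (A k) z * f (J (snd z)) (snd z) \<partial>Q))"
      by (rule Q.integral_weighted_cover[OF I A c cover int])
    also have "\<dots> = (\<Sum>k\<in>I. case k of (i, j) \<Rightarrow> p i j / real N * f j (\<xi> i j))"
    proof (intro sum.cong refl)
      fix k assume k: "k \<in> I"
      obtain i j where ij: "k = (i, j)" "i \<in> {1..N}" "j \<in> {1..K}"
        using k by (auto simp: I_def)
      have eq: "(\<integral>z. indicator (A k) z * f (J (snd z)) (snd z) \<partial>Q) = (\<integral>z. indicator (A k) z * f j (snd z) \<partial>Q)"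
        by (intro Bochner_Integration.integral_cong refl) (auto simp: A_def ij indicator_def)
      have "(\<integral>z. indicator (A k) z * f j (snd z) \<partial>Q) = Q.prob (A k) * f j (\<xi> i j)"
      proof (cases "0 < Q.prob (A k)")
        case True
        let ?Q = "uniform_measure Q (A k)"
        interpret U: prob_space ?Q
          by (rule cond_prob[OF True])
        have int_U: "integrable ?Q snd"
          by (rule Q.integrable_uniform_measure[OF A True int_snd])
        have "\<xi> i j = (\<integral>z. snd z \<partial>?Q)"
          using True by (simp add: \<xi>_def ij)
        then have "f j (\<xi> i j) = (\<integral>z. f j (snd z) \<partial>?Q)"
          unfolding hr(2)[OF ij(3)]
          using integral_bounded_linear[OF hr(1)[OF ij(3)] int_U] integrable_bounded_linear[OF hr(1)[OF ij(3)] int_U]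
          by (simp add: U.prob_space[unfolded space_uniform_measure])
        also have "\<dots> = (1 / Q.prob (A k)) *\<^sub>R (\<integral>z. indicator (A k) z *\<^sub>R f j (snd z) \<partial>Q)"
          by (rule Q.integral_uniform_measure[OF A True int_f[OF ij(3)]])
        finally show ?thesis
          using True by simp
      next
        case False
        then have "A k \<in> null_sets Q"
          using A by (auto simp: null_sets_def Q.emeasure_eq_measure zero_less_measure_iff)
        then have "AE z in Q. z \<notin> A k"
          by (rule AE_not_in)
        then have "AE z in Q. indicator (A k) z * f j (snd z) = 0"
          by eventually_elim simp
        then have "(\<integral>z. indicator (A k) z * f j (snd z) \<partial>Q) = 0"
          by (rule integral_eq_zero_AE)
        with False show ?thesis
          by (simp add: zero_less_measure_iff)
      qed
      then have "c k * (\<integral>z. indicator (A k) z * f (J (snd z)) (snd z) \<partial>Q) = w k * f j (\<xi> i j)"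
        by (simp add: eq w_def)
      then show "c k * (\<integral>z. indicator (A k) z * f (J (snd z)) (snd z) \<partial>Q) = (case k of (i, j) \<Rightarrow> p i j / real N * f j (\<xi> i j))"
        by (simp add: ij w_eq)
    qed
    also have "\<dots> = 1 / real N * (\<Sum>i=1..N. \<Sum>j=1..K. p i j * f j (\<xi> i j))"
      unfolding I_def sum.cartesian_product[symmetric] by (simp add: sum_distrib_left)
    finally show "(\<integral>z. f (J (snd z)) (snd z) \<partial>Q) = 1 / real N * (\<Sum>i=1..N. \<Sum>j=1..K. p i j * f j (\<xi> i j))" .
  qed
  show ?thesis
  proof (rule that)
    show "0 \<le> p i j \<and> \<xi> i j \<in> \<Xi>" if "i \<in> {1..N}" "j \<in> {1..K}" for i j
      using that by (simp add: p_def w \<xi>_mem)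
  qed (rule sum_p transport_le affine; assumption)+
qed

section \<open>Worst-case expectation as a finite-dimensional problem\<close>

lemma is_affine_measurable:
  fixes f :: "'a::euclidean_space \<Rightarrow> real"
  assumes "is_affine f"
  shows "f \<in> borel_measurable borel"
proof -
  obtain h c where h: "linear h" and f: "f = (\<lambda>x. h x + c)"
    using assms by (auto simp: is_affine_def)
  have "h \<in> borel_measurable borel"
    using h by (intro borel_measurable_continuous_onI linear_continuous_on) (simp add: linear_conv_bounded_linear)
  then show ?thesis
    unfolding f by simp
qed

theorem theorem2:
  fixes \<Xi> :: "(real ^ 'm) set"
    and N K :: nat
    and xh :: "nat \<Rightarrow> real ^ 'm"
    and \<epsilon> :: real
    and nrm :: "real ^ 'm \<Rightarrow> real"
    and S :: "'s measure"
    and \<rho> :: "('s \<Rightarrow> real) \<Rightarrow> ennreal"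
    and loss :: "real ^ 'm \<Rightarrow> real"
    and piece :: "nat \<Rightarrow> real ^ 'm \<Rightarrow> real"
  assumes "convex \<Xi>"
    and "1 \<le> N"
    and "\<forall>i\<in>{1..N}. xh i \<in> \<Xi>"
    and "0 \<le> \<epsilon>"
    and "is_norm nrm"
    and "law_invariant_coherent_risk S \<rho>"
    and "1 \<le> K"
    and "\<forall>k\<in>{1..K}. is_affine (piece k)"
    and "\<forall>x. loss x = Max ((\<lambda>k. piece k x) ` {1..K})"
  shows "(SUP Q \<in> {Q \<in> couplings \<Xi> N xh. transport_risk S \<rho> nrm Q \<le> ennreal \<epsilon>}.
            ext_expectation Q (\<lambda>(x, y). loss y))
       = (SUP (p, \<xi>) \<in> {(p, \<xi>).
              transport_risk S \<rho> nrm (discrete_coupling \<Xi> N K xh p \<xi>) \<le> ennreal \<epsilon> \<and>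
              (\<forall>i\<in>{1..N}. \<forall>j\<in>{1..K}. 0 \<le> p i j \<and> \<xi> i j \<in> \<Xi>) \<and>
              (\<forall>i\<in>{1..N}. (\<Sum>j=1..K. p i j) = 1)}.
            ereal (1 / real N * (\<Sum>i=1..N. \<Sum>j=1..K. p i j * piece j (\<xi> i j))))"
proof -
  interpret law_invariant_coherent_risk S \<rho> by fact
  have xh: "\<And>i. i \<in> {1..N} \<Longrightarrow> xh i \<in> \<Xi>" and N: "1 \<le> N"
    using assms by auto
  have piece_meas: "piece k \<in> borel_measurable borel" if "k \<in> {1..K}" for k
    using assms(8) that is_affine_measurable by blast
  have loss_eq: "loss = (\<lambda>x. Max ((\<lambda>k. piece k x) ` {1..K}))"
    using assms(9) by blast
  have loss_meas: "loss \<in> borel_measurable borel"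
    unfolding loss_eq by (rule borel_measurable_Max) (use piece_meas in auto)
  have piece_le: "piece k y \<le> loss y" if "k \<in> {1..K}" for k y
    unfolding loss_eq using that by (intro Max_ge) auto
  define J where "J y = (LEAST j. j \<in> {1..K} \<and> piece j y = loss y)" for y
  have J: "J y \<in> {1..K} \<and> piece (J y) y = loss y" for y
    unfolding J_def
  proof (rule LeastI_ex)
    have "loss y \<in> (\<lambda>k. piece k y) ` {1..K}"
      unfolding loss_eq using assms(7) by (intro Max_in) auto
    then show "\<exists>j. j \<in> {1..K} \<and> piece j y = loss y"
      by force
  qed
  have J_meas: "J \<in> measurable borel (count_space UNIV)"
    unfolding J_def
  proof (rule measurable_Least)
    fix j
    show "Measurable.pred borel (\<lambda>y. j \<in> {1..K} \<and> piece j y = loss y)"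
    proof (cases "j \<in> {1..K}")
      case True
      have "Measurable.pred borel (\<lambda>y. piece j y = loss y)"
        unfolding pred_def by (rule borel_measurable_eq[OF piece_meas[OF True] loss_meas])
      with True show ?thesis
        by (simp only: simp_thms)
    next
      case False
      then show ?thesis
        by (simp only: simp_thms) simp
    qed
  qed
  show ?thesis
  proof (rule antisym; rule SUP_least)
    fix Q assume "Q \<in> {Q \<in> couplings \<Xi> N xh. transport_risk S \<rho> nrm Q \<le> ennreal \<epsilon>}"
    then have Q: "Q \<in> couplings \<Xi> N xh" "transport_risk S \<rho> nrm Q \<le> ennreal \<epsilon>"
      by auto
    have finite: "transport_risk S \<rho> nrm Q < \<infinity>"
      using Q(2) by (rule order.strict_trans1) simp
    show "ext_expectation Q (\<lambda>(x, y). loss y) \<le> (SUP (p, \<xi>) \<in> {(p, \<xi>).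
              transport_risk S \<rho> nrm (discrete_coupling \<Xi> N K xh p \<xi>) \<le> ennreal \<epsilon> \<and>
              (\<forall>i\<in>{1..N}. \<forall>j\<in>{1..K}. 0 \<le> p i j \<and> \<xi> i j \<in> \<Xi>) \<and>
              (\<forall>i\<in>{1..N}. (\<Sum>j=1..K. p i j) = 1)}.
            ereal (1 / real N * (\<Sum>i=1..N. \<Sum>j=1..K. p i j * piece j (\<xi> i j))))"
    proof (rule coupling_discretization[OF assms(1) N xh assms(5) Q(1) finite J_meas])
      show "J y \<in> {1..K}" for y
        using J by blast
      fix p \<xi>
      assume p\<xi>: "\<And>i j. i \<in> {1..N} \<Longrightarrow> j \<in> {1..K} \<Longrightarrow> 0 \<le> p i j \<and> \<xi> i j \<in> \<Xi>"
        "\<And>i. i \<in> {1..N} \<Longrightarrow> (\<Sum>j=1..K. p i j) = 1"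
        and risk: "transport_risk S \<rho> nrm (discrete_coupling \<Xi> N K xh p \<xi>) \<le> transport_risk S \<rho> nrm Q"
        and affine: "\<And>f. (\<And>j. j \<in> {1..K} \<Longrightarrow> is_affine (f j)) \<Longrightarrow>
         (\<lambda>y. f (J y) y) \<in> borel_measurable borel \<Longrightarrow>
         integrable Q (\<lambda>z. f (J (snd z)) (snd z)) \<and>
         (\<integral>z. f (J (snd z)) (snd z) \<partial>Q) = 1 / real N * (\<Sum>i=1..N. \<Sum>j=1..K. p i j * f j (\<xi> i j))"
      have "integrable Q (\<lambda>z. piece (J (snd z)) (snd z)) \<and>
         (\<integral>z. piece (J (snd z)) (snd z) \<partial>Q) = 1 / real N * (\<Sum>i=1..N. \<Sum>j=1..K. p i j * piece j (\<xi> i j))"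
        by (rule affine) (use assms(8) J loss_meas in auto)
      moreover have eq: "(\<lambda>(x, y). loss y) = (\<lambda>z. piece (J (snd z)) (snd z))"
        using J by (simp add: fun_eq_iff)
      ultimately have "ext_expectation Q (\<lambda>(x, y). loss y) = ereal (1 / real N * (\<Sum>i=1..N. \<Sum>j=1..K. p i j * piece j (\<xi> i j)))"
        using ext_expectation_integrable[of Q "\<lambda>z. piece (J (snd z)) (snd z)"] by (simp only: eq)
      also have "\<dots> \<le> (SUP (p, \<xi>) \<in> {(p, \<xi>).
              transport_risk S \<rho> nrm (discrete_coupling \<Xi> N K xh p \<xi>) \<le> ennreal \<epsilon> \<and>
              (\<forall>i\<in>{1..N}. \<forall>j\<in>{1..K}. 0 \<le> p i j \<and> \<xi> i j \<in> \<Xi>) \<and>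
              (\<forall>i\<in>{1..N}. (\<Sum>j=1..K. p i j) = 1)}.
            ereal (1 / real N * (\<Sum>i=1..N. \<Sum>j=1..K. p i j * piece j (\<xi> i j))))"
        by (rule SUP_upper2[of "(p, \<xi>)"]) (use p\<xi> order.trans[OF risk Q(2)] in auto)
      finally show ?thesis .
    qed
  next
    fix r :: "(nat \<Rightarrow> nat \<Rightarrow> real) \<times> (nat \<Rightarrow> nat \<Rightarrow> real ^ 'm)"
    assume "r \<in> {(p, \<xi>).
              transport_risk S \<rho> nrm (discrete_coupling \<Xi> N K xh p \<xi>) \<le> ennreal \<epsilon> \<and>
              (\<forall>i\<in>{1..N}. \<forall>j\<in>{1..K}. 0 \<le> p i j \<and> \<xi> i j \<in> \<Xi>) \<and>
              (\<forall>i\<in>{1..N}. (\<Sum>j=1..K. p i j) = 1)}"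
    then obtain p \<xi> where r: "r = (p, \<xi>)"
      and risk: "transport_risk S \<rho> nrm (discrete_coupling \<Xi> N K xh p \<xi>) \<le> ennreal \<epsilon>"
      and p\<xi>: "\<And>i j. i \<in> {1..N} \<Longrightarrow> j \<in> {1..K} \<Longrightarrow> 0 \<le> p i j \<and> \<xi> i j \<in> \<Xi>"
      and sum_p: "\<And>i. i \<in> {1..N} \<Longrightarrow> (\<Sum>j=1..K. p i j) = 1"
      by blast
    have "(\<Sum>i=1..N. \<Sum>j=1..K. p i j * piece j (\<xi> i j)) \<le> (\<Sum>i=1..N. \<Sum>j=1..K. p i j * loss (\<xi> i j))"
      using p\<xi> by (intro sum_mono mult_left_mono piece_le) auto
    then have "ereal (1 / real N * (\<Sum>i=1..N. \<Sum>j=1..K. p i j * piece j (\<xi> i j)))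
        \<le> ereal (1 / real N * (\<Sum>i=1..N. \<Sum>j=1..K. p i j * loss (\<xi> i j)))"
      unfolding ereal_less_eq by (rule mult_left_mono) simp
    also have "\<dots> = ext_expectation (discrete_coupling \<Xi> N K xh p \<xi>) (\<lambda>(x, y). loss y)"
      by (rule ext_expectation_discrete_coupling[OF xh p\<xi> loss_meas, symmetric])
    also have "\<dots> \<le> (SUP Q \<in> {Q \<in> couplings \<Xi> N xh. transport_risk S \<rho> nrm Q \<le> ennreal \<epsilon>}.
            ext_expectation Q (\<lambda>(x, y). loss y))"
      by (rule SUP_upper) (use risk discrete_coupling_feasible[OF N xh p\<xi> sum_p] in simp)
    finally show "(case r of (p, \<xi>) \<Rightarrow> ereal (1 / real N * (\<Sum>i=1..N. \<Sum>j=1..K. p i j * piece j (\<xi> i j)))) \<le> \<dots>"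
      by (simp add: r)
  qed
qed

end
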